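(* Let $K$ be a field and let $(A,\circ,[\cdot,\cdot])$ be a Gel'fand-Dorfman bialgebra over $K$ which is a subspace of codimension $1$ in a vector space $E$. Then there are bijections $$\mathrm{Extd}(E,A)\cong\mathcal{GH}^2(K,A)\cong\mathcal{F}(A)/\equiv,$$ where $\equiv$ is the equivalence relation on the set $\mathcal{F}(A)$ of all Gel'fand-Dorfman flag datums of $(A,\circ,[\cdot,\cdot])$ defined as follows: $(p,q,S,T,a_1,k,\eta,D)\equiv(p',q',S',T',a_1',k',\eta',D')$ if and only if $p=p'$, $q=q'$, $\eta=\eta'$ and there exists a pair $(a_0,\beta)\in A\times K^{*}$ such that for all $a\in A$: (FD1) $S(a)=a_0\circ a+\beta S'(a)-q(a)a_0$; (FD2) $T(a)=a\circ a_0+\beta T'(a)-p(a)a_0$; (FD3) $a_1=a_0\circ a_0+\beta S'(a_0)+\beta T'(a_0)+\beta^2a_1'-ka_0$; (FD4) $k=\beta k'+p(a_0)+q(a_0)$; (FD5) $D(a)=\beta D'(a)+[a_0,a]-\eta(a)a_0$. The bijection between $\mathcal{F}(A)/\equiv$ and $\mathrm{Extd}(E,A)$ is given by $$\overline{(p,q,S,T,a_1,k,\eta,D)}\mapsto GD(A,x\mid p,q,S,T,a_1,k,\eta,D),$$ where $\overline{(p,q,S,T,a_1,k,\eta,D)}$ is the equivalence class of $(p,q,S,T,a_1,k,\eta,D)$ under $\equiv$.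
   Context: All vector spaces, algebras and (bi)linear maps are over a field $K$; $K^*=K\setminus\{0\}$. A Novikov algebra $(A,\circ)$ is a vector space with a bilinear product such that $(a\circ b)\circ c-a\circ(b\circ c)=(b\circ a)\circ c-b\circ(a\circ c)$ and $(a\circ b)\circ c=(a\circ c)\circ b$. A Lie algebra satisfies $[x,x]=0$ and the Jacobi identity. A Gel'fand-Dorfman bialgebra $(A,\circ,[\cdot,\cdot])$ is a vector space such that $(A,\circ)$ is a Novikov algebra, $(A,[\cdot,\cdot])$ is a Lie algebra, and $[a,b\circ c]-[c,b\circ a]+[b,a]\circ c-[b,c]\circ a-b\circ[a,c]=0$ for all $a,b,c\in A$. Homomorphisms are linear maps preserving both operations; subalgebras are subspaces closed under both. $\mathrm{Extd}(E,A)$: the set of all Gel'fand-Dorfman bialgebraic structures on $E$ containing $(A,\circ,[\cdot,\cdot])$ as a subalgebra, modulo isomorphisms of Gel'fand-Dorfman bialgebras $E\to E$ restricting to the identity on $A$. Extending datum of $A$ by a vector space $V$: a system $\Omega(A,V)=(l_A,r_A,l_V,r_V,f,\ast,\triangleleft,\triangleright,h,\{\cdot,\cdot\})$ of linear maps $l_A,r_A:A\to gl(V)$, $l_V,r_V:V\to gl(A)$ and bilinear maps $f,h:V\times V\to A$, $\ast,\{\cdot,\cdot\}:V\times V\to V$, $\triangleleft:V\times A\to V$, $\triangleright:V\times A\to A$. $A\natural V$ is $A\times V$ with $(a,x)\circ(b,y)=(a\circ b+l_V(x)b+r_V(y)a+f(x,y),\ x\ast y+l_A(a)y+r_A(b)x)$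 and $[(a,x),(b,y)]=([a,b]+x\triangleright b-y\triangleright a+h(x,y),\ \{x,y\}+x\triangleleft b-y\triangleleft a)$. If this is a Gel'fand-Dorfman bialgebra, it is called the unified product and $\Omega(A,V)$ a Gel'fand-Dorfman extending structure of $A$ by $V$; $\mathcal{GD}(A,V)$ is the set of these. $\mathcal{GH}^2(V,A)=\mathcal{GD}(A,V)/\equiv$, where $\Omega(A,V)\equiv\Omega'(A,V)$ if there are a linear map $\lambda:V\to A$ and a linear automorphism $\mu$ of $V$ such that for all $a\in A$, $x,y\in V$: $r_A(a)x=\mu^{-1}(r_A'(a)\mu(x))$; $l_A(a)x=\mu^{-1}(l_A'(a)\mu(x))$; $l_V(x)a=\lambda(x)\circ a+l_V'(\mu(x))a-\lambda\mu^{-1}(r_A'(a)\mu(x))$; $r_V(x)a=a\circ\lambda(x)+r_V'(\mu(x))a-\lambda\mu^{-1}(l_A'(a)\mu(x))$; $x\ast y=\mu^{-1}(\mu(x)\ast'\mu(y))+\mu^{-1}(l_A'(\lambda(x))\mu(y))+\mu^{-1}(r_A'(\lambda(y))\mu(x))$; $f(x,y)=\lambda(x)\circ\lambda(y)+l_V'(\mu(x))\lambda(y)+r_V'(\mu(y))\lambda(x)+f'(\mu(x),\mu(y))-\lambda\mu^{-1}(\mu(x)\ast'\mu(y))-\lambda\mu^{-1}(l_A'(\lambda(x))\mu(y))-\lambda\mu^{-1}(r_A'(\lambda(y))\mu(x))$; $x\triangleleft a=\mu^{-1}(\mu(x)\triangleleft' a)$; $x\triangleright a=[\lambda(x),a]+\mu(x)\triangleright'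 a-\lambda\mu^{-1}(\mu(x)\triangleleft' a)$; $h(x,y)=[\lambda(x),\lambda(y)]+\mu(x)\triangleright'\lambda(y)-\mu(y)\triangleright'\lambda(x)+h'(\mu(x),\mu(y))-\lambda\mu^{-1}(\{\mu(x),\mu(y)\}')-\lambda\mu^{-1}(\mu(x)\triangleleft'\lambda(y))+\lambda\mu^{-1}(\mu(y)\triangleleft'\lambda(x))$; $\{x,y\}=\mu^{-1}(\{\mu(x),\mu(y)\}')+\mu^{-1}(\mu(x)\triangleleft'\lambda(y))-\mu^{-1}(\mu(y)\triangleleft'\lambda(x))$. $\mathcal{GH}^2(K,A)$ is the case where $V$ is one-dimensional. A Gel'fand-Dorfman flag datum of $(A,\circ,[\cdot,\cdot])$ is an 8-tuple $(p,q,S,T,a_1,k,\eta,D)$ with linear maps $p,q,\eta:A\to K$, $S,T,D:A\to A$, and $a_1\in A$, $k\in K$, such that for all $a,b\in A$: (GF0) $(p,q,S,T,a_1,k)$ is a Novikov flag datum of $(A,\circ)$, i.e. (FN1) $p(a\circ b)=p(b\circ a)$, $q(a\circ b)=q(a)q(b)$; (FN2) $S(a\circ b)=S(a)\circ b+a\circ S(b)+(q(a)-p(a))S(b)+q(b)T(a)-T(a)\circ b$; (FN3) $T(a\circ b)-T(b\circ a)=p(b)T(a)-p(a)T(b)+a\circ T(b)-b\circ T(a)$; (FN4) $T^2(a)=T(S(a))-S(T(a))+a\circ a_1+(q(a)-2p(a))a_1+kT(a)$; (FN5) $p(S(a))-p(T(a))=q(T(a))+k(p(a)-q(a))$; (FN6)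 $S(a)\circ b+q(a)S(b)=S(b)\circ a+q(b)S(a)$; (FN7) $T(a\circ b)=T(a)\circ b+p(a)S(b)$; (FN8) $p(a\circ b)=p(a)q(b)$; (FN9) $T(S(a))=a_1\circ a+kS(a)-q(a)a_1$; (FN10) $p(S(a))=0$; and $(\eta,D)$ is a twisted derivation of $(A,[\cdot,\cdot])$, i.e. $\eta([a,b])=0$ and $D([a,b])=[D(a),b]+[a,D(b)]+\eta(a)D(b)-\eta(b)D(a)$; (GF1) $[a,T(b)]-p(b)D(a)-D(b\circ a)+T([b,a])+D(b)\circ a+\eta(b)S(a)+b\circ D(a)+\eta(a)T(b)=0$; (GF2) $p([b,a])+\eta(b)q(a)-\eta(b\circ a)=0$; (GF3) $[a,S(b)]-q(b)D(a)-[b,S(a)]+q(a)D(b)+D(a)\circ b+\eta(a)S(b)-D(b)\circ a-\eta(b)S(a)-S([a,b])=0$; (GF4) $q([a,b])=0$; (GF5) $[a,a_1]-kD(a)-D(S(a))+T(D(a))+2\eta(a)a_1+S(D(a))=0$; (GF6) $k\eta(a)-\eta(S(a))+p(D(a))+q(D(a))=0$. Let $V=Kx$ be a (one-dimensional) complement of $A$ in $E$ with basis $\{x\}$. The flag datum $(p,q,S,T,a_1,k,\eta,D)$ corresponds to the extending structure of $A$ by $V$ with $l_A(a)x=p(a)x$, $r_A(a)x=q(a)x$, $l_V(x)a=S(a)$, $r_V(x)a=T(a)$, $f(x,x)=a_1$, $x\ast x=kx$, $x\triangleleft a=\eta(a)x$, $x\triangleright a=D(a)$, $h=0$, $\{\cdot,\cdot\}=0$.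 $GD(A,x\mid p,q,S,T,a_1,k,\eta,D)$ denotes the associated unified product $A\natural V$, regarded as a structure on $E$ via $(a,v)\mapsto a+v$ and representing its class in $\mathrm{Extd}(E,A)$. *)

theory Defs
  imports "HOL-Analysis.Product_Vector"
begin

definition bilinear_map ::
  "('k::field \<Rightarrow> 'a::ab_group_add \<Rightarrow> 'a) \<Rightarrow> ('k \<Rightarrow> 'b::ab_group_add \<Rightarrow> 'b) \<Rightarrow>
   ('k \<Rightarrow> 'c::ab_group_add \<Rightarrow> 'c) \<Rightarrow> ('a \<Rightarrow> 'b \<Rightarrow> 'c) \<Rightarrow> bool" where
  "bilinear_map s1 s2 s3 B \<longleftrightarrow>
     (\<forall>x. Vector_Spaces.linear s2 s3 (\<lambda>y. B x y)) \<and> (\<forall>y. Vector_Spaces.linear s1 s3 (\<lambda>x. B x y))"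

locale novikov_algebra = vector_space scale
  for scale :: "'k::field \<Rightarrow> 'a::ab_group_add \<Rightarrow> 'a" +
  fixes circ :: "'a \<Rightarrow> 'a \<Rightarrow> 'a"
  assumes circ_bilinear: "bilinear_map scale scale scale circ"
    and circ_left_symmetric:
      "circ (circ a b) c - circ a (circ b c) = circ (circ b a) c - circ b (circ a c)"
    and circ_right_commute: "circ (circ a b) c = circ (circ a c) b"

locale lie_algebra = vector_space scale
  for scale :: "'k::field \<Rightarrow> 'a::ab_group_add \<Rightarrow> 'a" +
  fixes br :: "'a \<Rightarrow> 'a \<Rightarrow> 'a"
  assumes br_bilinear: "bilinear_map scale scale scale br"
    and br_self: "br a a = 0"
    and br_jacobi: "br a (br b c) + br b (br c a) + br c (br a b) = 0"

locale gd_bialgebra = novikov_algebra scale circ + lie_algebra scale br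
  for scale :: "'k::field \<Rightarrow> 'a::ab_group_add \<Rightarrow> 'a"
    and circ :: "'a \<Rightarrow> 'a \<Rightarrow> 'a" and br :: "'a \<Rightarrow> 'a \<Rightarrow> 'a" +
  assumes gd_compat:
    "br a (circ b c) - br c (circ b a) + circ (br b a) c - circ (br b c) a - circ b (br a c) = 0"

definition gd_hom ::
  "('k::field \<Rightarrow> 'a::ab_group_add \<Rightarrow> 'a) \<Rightarrow> ('a \<Rightarrow> 'a \<Rightarrow> 'a) \<Rightarrow> ('a \<Rightarrow> 'a \<Rightarrow> 'a) \<Rightarrow>
   ('k \<Rightarrow> 'b::ab_group_add \<Rightarrow> 'b) \<Rightarrow> ('b \<Rightarrow> 'b \<Rightarrow> 'b) \<Rightarrow> ('b \<Rightarrow> 'b \<Rightarrow> 'b) \<Rightarrow> ('a \<Rightarrow> 'b) \<Rightarrow> bool" where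
  "gd_hom s1 circ1 br1 s2 circ2 br2 \<phi> \<longleftrightarrow>
     Vector_Spaces.linear s1 s2 \<phi> \<and>
     (\<forall>a b. \<phi> (circ1 a b) = circ2 (\<phi> a) (\<phi> b)) \<and>
     (\<forall>a b. \<phi> (br1 a b) = br2 (\<phi> a) (\<phi> b))"

text \<open>The inclusion of \<open>A\<close> into \<open>E\<close> is an injective linear map \<open>\<iota>\<close>; thus \<open>A\<close> is a subalgebra
  of a structure on \<open>E\<close> iff \<open>\<iota>\<close> preserves both operations, and a map on \<open>E\<close> restricts to the
  identity on \<open>A\<close> iff it fixes every \<open>\<iota> a\<close>. A structure on a space is the pair of its operations.\<close>

type_synonym 'e gd_structure = "('e \<Rightarrow> 'e \<Rightarrow> 'e) \<times> ('e \<Rightarrow> 'e \<Rightarrow> 'e)"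

definition ext_structures ::
  "('k::field \<Rightarrow> 'e::ab_group_add \<Rightarrow> 'e) \<Rightarrow> ('k \<Rightarrow> 'a::ab_group_add \<Rightarrow> 'a) \<Rightarrow>
   ('a \<Rightarrow> 'a \<Rightarrow> 'a) \<Rightarrow> ('a \<Rightarrow> 'a \<Rightarrow> 'a) \<Rightarrow> ('a \<Rightarrow> 'e) \<Rightarrow> 'e gd_structure set" where
  "ext_structures sE sA circ br \<iota> =
     {(circE, brE). gd_bialgebra sE circE brE \<and> gd_hom sA circ br sE circE brE \<iota>}"

definition ext_iso ::
  "('k::field \<Rightarrow> 'e::ab_group_add \<Rightarrow> 'e) \<Rightarrow> ('k \<Rightarrow> 'a::ab_group_add \<Rightarrow> 'a) \<Rightarrow>
   ('a \<Rightarrow> 'a \<Rightarrow> 'a) \<Rightarrow> ('a \<Rightarrow> 'a \<Rightarrow> 'a) \<Rightarrow> ('a \<Rightarrow> 'e) \<Rightarrow> ('e gd_structure \<times> 'e gd_structure) set" where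
  "ext_iso sE sA circ br \<iota> =
     {((circ1, br1), (circ2, br2)).
        (circ1, br1) \<in> ext_structures sE sA circ br \<iota> \<and>
        (circ2, br2) \<in> ext_structures sE sA circ br \<iota> \<and>
        (\<exists>\<phi>. gd_hom sE circ1 br1 sE circ2 br2 \<phi> \<and> bij \<phi> \<and> (\<forall>a. \<phi> (\<iota> a) = \<iota> a))}"

definition Extd ::
  "('k::field \<Rightarrow> 'e::ab_group_add \<Rightarrow> 'e) \<Rightarrow> ('k \<Rightarrow> 'a::ab_group_add \<Rightarrow> 'a) \<Rightarrow>
   ('a \<Rightarrow> 'a \<Rightarrow> 'a) \<Rightarrow> ('a \<Rightarrow> 'a \<Rightarrow> 'a) \<Rightarrow> ('a \<Rightarrow> 'e) \<Rightarrow> 'e gd_structure set set" where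
  "Extd sE sA circ br \<iota> = ext_structures sE sA circ br \<iota> // ext_iso sE sA circ br \<iota>"

text \<open>The fields are, in order, \<open>l\<^sub>A, r\<^sub>A, l\<^sub>V, r\<^sub>V, f, \<ast>, \<triangleleft>, \<triangleright>, h, {\<cdot>,\<cdot>}\<close>.\<close>

record ('a, 'v) ext_datum =
  lA :: "'a \<Rightarrow> 'v \<Rightarrow> 'v"
  rA :: "'a \<Rightarrow> 'v \<Rightarrow> 'v"
  lV :: "'v \<Rightarrow> 'a \<Rightarrow> 'a"
  rV :: "'v \<Rightarrow> 'a \<Rightarrow> 'a"
  fV :: "'v \<Rightarrow> 'v \<Rightarrow> 'a"
  starV :: "'v \<Rightarrow> 'v \<Rightarrow> 'v"
  triL :: "'v \<Rightarrow> 'a \<Rightarrow> 'v"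
  triR :: "'v \<Rightarrow> 'a \<Rightarrow> 'a"
  hV :: "'v \<Rightarrow> 'v \<Rightarrow> 'a"
  brV :: "'v \<Rightarrow> 'v \<Rightarrow> 'v"

definition is_ext_datum ::
  "('k::field \<Rightarrow> 'a::ab_group_add \<Rightarrow> 'a) \<Rightarrow> ('k \<Rightarrow> 'v::ab_group_add \<Rightarrow> 'v) \<Rightarrow>
   ('a, 'v) ext_datum \<Rightarrow> bool" where
  "is_ext_datum sA sV \<Omega> \<longleftrightarrow>
     bilinear_map sA sV sV (lA \<Omega>) \<and> bilinear_map sA sV sV (rA \<Omega>) \<and>
     bilinear_map sV sA sA (lV \<Omega>) \<and> bilinear_map sV sA sA (rV \<Omega>) \<and>
     bilinear_map sV sV sA (fV \<Omega>) \<and> bilinear_map sV sV sV (starV \<Omega>) \<and>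
     bilinear_map sV sA sV (triL \<Omega>) \<and> bilinear_map sV sA sA (triR \<Omega>) \<and>
     bilinear_map sV sV sA (hV \<Omega>) \<and> bilinear_map sV sV sV (brV \<Omega>)"

definition unified_circ ::
  "('a::ab_group_add \<Rightarrow> 'a \<Rightarrow> 'a) \<Rightarrow> ('a, 'v::ab_group_add) ext_datum \<Rightarrow>
   'a \<times> 'v \<Rightarrow> 'a \<times> 'v \<Rightarrow> 'a \<times> 'v" where
  "unified_circ circ \<Omega> = (\<lambda>(a, x) (b, y).
     (circ a b + lV \<Omega> x b + rV \<Omega> y a + fV \<Omega> x y,
      starV \<Omega> x y + lA \<Omega> a y + rA \<Omega> b x))"

definition unified_br ::
  "('a::ab_group_add \<Rightarrow> 'a \<Rightarrow> 'a) \<Rightarrow> ('a, 'v::ab_group_add) ext_datum \<Rightarrow>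
   'a \<times> 'v \<Rightarrow> 'a \<times> 'v \<Rightarrow> 'a \<times> 'v" where
  "unified_br br \<Omega> = (\<lambda>(a, x) (b, y).
     (br a b + triR \<Omega> x b - triR \<Omega> y a + hV \<Omega> x y,
      brV \<Omega> x y + triL \<Omega> x b - triL \<Omega> y a))"

definition GD ::
  "('k::field \<Rightarrow> 'a::ab_group_add \<Rightarrow> 'a) \<Rightarrow> ('a \<Rightarrow> 'a \<Rightarrow> 'a) \<Rightarrow> ('a \<Rightarrow> 'a \<Rightarrow> 'a) \<Rightarrow>
   ('k \<Rightarrow> 'v::ab_group_add \<Rightarrow> 'v) \<Rightarrow> ('a, 'v) ext_datum set" where
  "GD sA circ br sV = {\<Omega>. is_ext_datum sA sV \<Omega> \<and>
     gd_bialgebra (module_prod.scale sA sV) (unified_circ circ \<Omega>) (unified_br br \<Omega>)}"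

definition GD_equiv ::
  "('k::field \<Rightarrow> 'a::ab_group_add \<Rightarrow> 'a) \<Rightarrow> ('a \<Rightarrow> 'a \<Rightarrow> 'a) \<Rightarrow> ('a \<Rightarrow> 'a \<Rightarrow> 'a) \<Rightarrow>
   ('k \<Rightarrow> 'v::ab_group_add \<Rightarrow> 'v) \<Rightarrow> (('a, 'v) ext_datum \<times> ('a, 'v) ext_datum) set" where
  "GD_equiv sA circ br sV = {(\<Omega>, \<Omega>').
     \<Omega> \<in> GD sA circ br sV \<and> \<Omega>' \<in> GD sA circ br sV \<and>
     (\<exists>lam mu. Vector_Spaces.linear sV sA lam \<and> Vector_Spaces.linear sV sV mu \<and> bij mu \<and>
       (\<forall>a x y.
         rA \<Omega> a x = inv mu (rA \<Omega>' a (mu x)) \<and>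
         lA \<Omega> a x = inv mu (lA \<Omega>' a (mu x)) \<and>
         lV \<Omega> x a = circ (lam x) a + lV \<Omega>' (mu x) a - lam (inv mu (rA \<Omega>' a (mu x))) \<and>
         rV \<Omega> x a = circ a (lam x) + rV \<Omega>' (mu x) a - lam (inv mu (lA \<Omega>' a (mu x))) \<and>
         starV \<Omega> x y = inv mu (starV \<Omega>' (mu x) (mu y)) + inv mu (lA \<Omega>' (lam x) (mu y))
           + inv mu (rA \<Omega>' (lam y) (mu x)) \<and>
         fV \<Omega> x y = circ (lam x) (lam y) + lV \<Omega>' (mu x) (lam y) + rV \<Omega>' (mu y) (lam x)
           + fV \<Omega>' (mu x) (mu y) - lam (inv mu (starV \<Omega>' (mu x) (mu y)))
           - lam (inv mu (lA \<Omega>' (lam x) (mu y))) - lam (inv mu (rA \<Omega>' (lam y) (mu x))) \<and>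
         triL \<Omega> x a = inv mu (triL \<Omega>' (mu x) a) \<and>
         triR \<Omega> x a = br (lam x) a + triR \<Omega>' (mu x) a - lam (inv mu (triL \<Omega>' (mu x) a)) \<and>
         hV \<Omega> x y = br (lam x) (lam y) + triR \<Omega>' (mu x) (lam y) - triR \<Omega>' (mu y) (lam x)
           + hV \<Omega>' (mu x) (mu y) - lam (inv mu (brV \<Omega>' (mu x) (mu y)))
           - lam (inv mu (triL \<Omega>' (mu x) (lam y))) + lam (inv mu (triL \<Omega>' (mu y) (lam x))) \<and>
         brV \<Omega> x y = inv mu (brV \<Omega>' (mu x) (mu y)) + inv mu (triL \<Omega>' (mu x) (lam y))
           - inv mu (triL \<Omega>' (mu y) (lam x))))}"

definition GH2 ::
  "('k::field \<Rightarrow> 'a::ab_group_add \<Rightarrow> 'a) \<Rightarrow> ('a \<Rightarrow> 'a \<Rightarrow> 'a) \<Rightarrow> ('a \<Rightarrow> 'a \<Rightarrow> 'a) \<Rightarrow>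
   ('k \<Rightarrow> 'v::ab_group_add \<Rightarrow> 'v) \<Rightarrow> ('a, 'v) ext_datum set set" where
  "GH2 sA circ br sV = GD sA circ br sV // GD_equiv sA circ br sV"

type_synonym ('k, 'a) flag_datum =
  "('a \<Rightarrow> 'k) \<times> ('a \<Rightarrow> 'k) \<times> ('a \<Rightarrow> 'a) \<times> ('a \<Rightarrow> 'a) \<times> 'a \<times> 'k \<times> ('a \<Rightarrow> 'k) \<times> ('a \<Rightarrow> 'a)"

definition novikov_flag_datum ::
  "('k::field \<Rightarrow> 'a::ab_group_add \<Rightarrow> 'a) \<Rightarrow> ('a \<Rightarrow> 'a \<Rightarrow> 'a) \<Rightarrow>
   ('a \<Rightarrow> 'k) \<Rightarrow> ('a \<Rightarrow> 'k) \<Rightarrow> ('a \<Rightarrow> 'a) \<Rightarrow> ('a \<Rightarrow> 'a) \<Rightarrow> 'a \<Rightarrow> 'k \<Rightarrow> bool" where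
  "novikov_flag_datum sA circ p q S T a1 k \<longleftrightarrow>
     Vector_Spaces.linear sA (*) p \<and> Vector_Spaces.linear sA (*) q \<and>
     Vector_Spaces.linear sA sA S \<and> Vector_Spaces.linear sA sA T \<and>
     (\<forall>a b.
       p (circ a b) = p (circ b a) \<and> q (circ a b) = q a * q b \<and>
       S (circ a b) = circ (S a) b + circ a (S b) + sA (q a - p a) (S b) + sA (q b) (T a)
         - circ (T a) b \<and>
       T (circ a b) - T (circ b a) = sA (p b) (T a) - sA (p a) (T b) + circ a (T b) - circ b (T a) \<and>
       T (T a) = T (S a) - S (T a) + circ a a1 + sA (q a - 2 * p a) a1 + sA k (T a) \<and>
       p (S a) - p (T a) = q (T a) + k * (p a - q a) \<and>
       circ (S a) b + sA (q a) (S b) = circ (S b) a + sA (q b) (S a) \<and>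
       T (circ a b) = circ (T a) b + sA (p a) (S b) \<and>
       p (circ a b) = p a * q b \<and>
       T (S a) = circ a1 a + sA k (S a) - sA (q a) a1 \<and>
       p (S a) = 0)"

definition twisted_derivation ::
  "('k::field \<Rightarrow> 'a::ab_group_add \<Rightarrow> 'a) \<Rightarrow> ('a \<Rightarrow> 'a \<Rightarrow> 'a) \<Rightarrow>
   ('a \<Rightarrow> 'k) \<Rightarrow> ('a \<Rightarrow> 'a) \<Rightarrow> bool" where
  "twisted_derivation sA br \<eta> D \<longleftrightarrow>
     Vector_Spaces.linear sA (*) \<eta> \<and> Vector_Spaces.linear sA sA D \<and>
     (\<forall>a b. \<eta> (br a b) = 0 \<and>
       D (br a b) = br (D a) b + br a (D b) + sA (\<eta> a) (D b) - sA (\<eta> b) (D a))"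

definition gd_flag_data ::
  "('k::field \<Rightarrow> 'a::ab_group_add \<Rightarrow> 'a) \<Rightarrow> ('a \<Rightarrow> 'a \<Rightarrow> 'a) \<Rightarrow> ('a \<Rightarrow> 'a \<Rightarrow> 'a) \<Rightarrow>
   ('k, 'a) flag_datum set" where
  "gd_flag_data sA circ br = {(p, q, S, T, a1, k, \<eta>, D).
     novikov_flag_datum sA circ p q S T a1 k \<and> twisted_derivation sA br \<eta> D \<and>
     (\<forall>a b.
       br a (T b) - sA (p b) (D a) - D (circ b a) + T (br b a) + circ (D b) a + sA (\<eta> b) (S a)
         + circ b (D a) + sA (\<eta> a) (T b) = 0 \<and>
       p (br b a) + \<eta> b * q a - \<eta> (circ b a) = 0 \<and>
       br a (S b) - sA (q b) (D a) - br b (S a) + sA (q a) (D b) + circ (D a) b + sA (\<eta> a) (S b)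
         - circ (D b) a - sA (\<eta> b) (S a) - S (br a b) = 0 \<and>
       q (br a b) = 0 \<and>
       br a a1 - sA k (D a) - D (S a) + T (D a) + sA (2 * \<eta> a) a1 + S (D a) = 0 \<and>
       k * \<eta> a - \<eta> (S a) + p (D a) + q (D a) = 0)}"

definition gd_flag_equiv ::
  "('k::field \<Rightarrow> 'a::ab_group_add \<Rightarrow> 'a) \<Rightarrow> ('a \<Rightarrow> 'a \<Rightarrow> 'a) \<Rightarrow> ('a \<Rightarrow> 'a \<Rightarrow> 'a) \<Rightarrow>
   (('k, 'a) flag_datum \<times> ('k, 'a) flag_datum) set" where
  "gd_flag_equiv sA circ br = {((p, q, S, T, a1, k, \<eta>, D), (p', q', S', T', a1', k', \<eta>', D')).
     (p, q, S, T, a1, k, \<eta>, D) \<in> gd_flag_data sA circ br \<and>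
     (p', q', S', T', a1', k', \<eta>', D') \<in> gd_flag_data sA circ br \<and>
     p = p' \<and> q = q' \<and> \<eta> = \<eta>' \<and>
     (\<exists>a0 \<beta>. \<beta> \<noteq> 0 \<and>
       (\<forall>a. S a = circ a0 a + sA \<beta> (S' a) - sA (q a) a0 \<and>
            T a = circ a a0 + sA \<beta> (T' a) - sA (p a) a0 \<and>
            a1 = circ a0 a0 + sA \<beta> (S' a0) + sA \<beta> (T' a0) + sA (\<beta>\<^sup>2) a1' - sA k a0 \<and>
            k = \<beta> * k' + p a0 + q a0 \<and>
            D a = sA \<beta> (D' a) + br a0 a - sA (\<eta> a) a0))}"

text \<open>The extending datum of \<open>A\<close> by \<open>V = Kx\<close> given by a flag datum on the basis vector \<open>x\<close>, extended
  linearly: \<open>c v\<close> is the coordinate of \<open>v\<close>, i.e. \<open>v = c v \<cdot> x\<close>.\<close>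

definition flag_ext_datum ::
  "('k::field \<Rightarrow> 'a::ab_group_add \<Rightarrow> 'a) \<Rightarrow> ('k \<Rightarrow> 'v::ab_group_add \<Rightarrow> 'v) \<Rightarrow> 'v \<Rightarrow>
   ('k, 'a) flag_datum \<Rightarrow> ('a, 'v) ext_datum" where
  "flag_ext_datum sA sV x = (\<lambda>(p, q, S, T, a1, k, \<eta>, D).
     let c = (\<lambda>v. module.representation sV {x} v x) in
     \<lparr> lA = (\<lambda>a v. sV (p a) v),
       rA = (\<lambda>a v. sV (q a) v),
       lV = (\<lambda>v a. sA (c v) (S a)),
       rV = (\<lambda>v a. sA (c v) (T a)),
       fV = (\<lambda>v w. sA (c v * c w) a1),
       starV = (\<lambda>v w. sV (c v * c w * k) x),
       triL = (\<lambda>v a. sV (\<eta> a) v),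
       triR = (\<lambda>v a. sA (c v) (D a)),
       hV = (\<lambda>v w. 0),
       brV = (\<lambda>v w. 0) \<rparr>)"

text \<open>The associated unified product, moved to \<open>E\<close> along \<open>(a, v) \<mapsto> \<iota> a + \<kappa> v\<close>, where \<open>\<kappa>\<close> is the
  inclusion of the complement \<open>V\<close>.\<close>

definition GD_flag ::
  "('k::field \<Rightarrow> 'a::ab_group_add \<Rightarrow> 'a) \<Rightarrow> ('a \<Rightarrow> 'a \<Rightarrow> 'a) \<Rightarrow> ('a \<Rightarrow> 'a \<Rightarrow> 'a) \<Rightarrow>
   ('k \<Rightarrow> 'v::ab_group_add \<Rightarrow> 'v) \<Rightarrow> ('a \<Rightarrow> 'e::ab_group_add) \<Rightarrow> ('v \<Rightarrow> 'e) \<Rightarrow> 'v \<Rightarrow>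
   ('k, 'a) flag_datum \<Rightarrow> 'e gd_structure" where
  "GD_flag sA circ br sV \<iota> \<kappa> x t =
     (let e = (\<lambda>(a, v). \<iota> a + \<kappa> v); \<Omega> = flag_ext_datum sA sV x t in
      (\<lambda>u w. e (unified_circ circ \<Omega> (inv e u) (inv e w)),
       \<lambda>u w. e (unified_br br \<Omega> (inv e u) (inv e w))))"

end

theory Submission
  imports Defs
begin

text \<open>A structure on a space containing \<open>A\<close> in codimension one is determined by the products of
  elements of \<open>A\<close> with one further basis vector \<open>x\<close>, and by \<open>x \<circ> x\<close>: the bracket is alternating, so
  \<open>h = 0\<close> and \<open>{\<cdot>,\<cdot>} = 0\<close>. The defining identities are trilinear, so they may be tested on
  \<open>A \<union> {x}\<close>, where their components along \<open>A\<close> and \<open>x\<close> are the flag datum axioms. An isomorphism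
  fixing \<open>A\<close> is given by \<open>x \<mapsto> a\<^sub>0 + \<beta> x\<close>, and multiplicativity on \<open>A \<union> {x}\<close> is (FD1)--(FD5).
  The same argument applied to \<open>A \<times> V\<close> and to \<open>E\<close> yields both bijections.\<close>

section \<open>Linear and bilinear maps with explicit scalings, and skew symmetry of the
  bracket\<close>

lemma bilinear_mapI:
  assumes "vector_space s1" "vector_space s2" "vector_space s3"
    and "\<And>x x' y. B (x + x') y = B x y + B x' y" "\<And>x y y'. B x (y + y') = B x y + B x y'"
    and "\<And>c x y. B (s1 c x) y = s3 c (B x y)" "\<And>c x y. B x (s2 c y) = s3 c (B x y)"
  shows "bilinear_map s1 s2 s3 B"
  using assms unfolding bilinear_map_def Vector_Spaces.linear_iff by blast

lemma bilinear_mapD: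
  assumes "bilinear_map s1 s2 s3 B"
  shows "B (x + x') y = B x y + B x' y" "B x (y + y') = B x y + B x y'"
    and "B (s1 c x) y = s3 c (B x y)" "B x (s2 c y) = s3 c (B x y)"
    and "B (x - x') y = B x y - B x' y" "B x (y - y') = B x y - B x y'"
    and "B (- x) y = - B x y" "B x (- y) = - B x y" "B 0 y = 0" "B x 0 = 0"
proof -
  interpret l: Vector_Spaces.linear s1 s3 "\<lambda>x. B x z" for z
    using assms by (simp add: bilinear_map_def)
  interpret r: Vector_Spaces.linear s2 s3 "\<lambda>y. B z y" for z
    using assms by (simp add: bilinear_map_def)
  show "B (x + x') y = B x y + B x' y" "B x (y + y') = B x y + B x y'"
    and "B (s1 c x) y = s3 c (B x y)" "B x (s2 c y) = s3 c (B x y)"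
    and "B (x - x') y = B x y - B x' y" "B x (y - y') = B x y - B x y'"
    and "B (- x) y = - B x y" "B x (- y) = - B x y" "B 0 y = 0" "B x 0 = 0"
    by (simp_all add: l.add r.add l.scale r.scale l.diff r.diff l.neg r.neg)
qed

lemma linear_mapD:
  assumes "Vector_Spaces.linear s1 s2 f"
  shows "f (x + y) = f x + f y" "f (s1 c x) = s2 c (f x)" "f (x - y) = f x - f y"
    and "f (- x) = - f x" "f 0 = 0"
proof -
  interpret Vector_Spaces.linear s1 s2 f by fact
  show "f (x + y) = f x + f y" "f (s1 c x) = s2 c (f x)" "f (x - y) = f x - f y"
    and "f (- x) = - f x" "f 0 = 0"
    by (simp_all add: add scale diff neg)
qed

lemma vector_space_field: "vector_space ((*) :: 'k::field \<Rightarrow> 'k \<Rightarrow> 'k)"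
  by unfold_locales (simp_all add: algebra_simps)

context gd_bialgebra
begin

lemmas circ_lin = bilinear_mapD[OF circ_bilinear]
lemmas br_lin = bilinear_mapD[OF br_bilinear]

text \<open>The axioms (FN4) and (GF5) carry the coefficients \<open>2 * p a\<close> and
  \<open>2 * \<eta> a\<close>, while expanding products yields the same summand twice. Splitting the
  coefficient brings both to one normal form, in any characteristic.\<close>

lemma scale_twice: "scale (2 * c) a = scale c a + scale c a" "scale (c * 2) a = scale c a + scale c a"
  unfolding scale_left_distrib[symmetric] by simp_all

lemma br_skew: "br b a = - br a b"
proof -
  have "br (a + b) (a + b) = 0" by (rule br_self)
  then have "br b a + br a b = 0" by (simp only: br_lin(1,2)) (simp add: br_self[of a] br_self[of b] add.commute)
  then show ?thesis by (simp add: eq_neg_iff_add_eq_0)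
qed

end

section \<open>Flag data as tuples, and coordinates on a space containing A in codimension
  one\<close>

lemma flag_cases:
  fixes t :: "('k, 'a) flag_datum"
  obtains p q S T a1 k \<eta> D where "t = (p, q, S, T, a1, k, \<eta>, D)"
  by (metis surj_pair)

text \<open>Only the linearity clauses of a flag datum. They already make the operations attached to
  a tuple bilinear, so a tuple can be read off a structure first and shown to satisfy the axioms
  afterwards.\<close>

fun linear_flag :: "('k::field \<Rightarrow> 'a::ab_group_add \<Rightarrow> 'a) \<Rightarrow> ('k, 'a) flag_datum \<Rightarrow> bool" where
  "linear_flag sA (p, q, S, T, a1, k, \<eta>, D) \<longleftrightarrow>
     Vector_Spaces.linear sA (*) p \<and> Vector_Spaces.linear sA (*) q \<and>
     Vector_Spaces.linear sA (*) \<eta> \<and> Vector_Spaces.linear sA sA S \<and>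
     Vector_Spaces.linear sA sA T \<and> Vector_Spaces.linear sA sA D"

lemma linear_flagD:
  assumes "linear_flag sA (p, q, S, T, a1, k, \<eta>, D)"
  shows "Vector_Spaces.linear sA (*) p" "Vector_Spaces.linear sA (*) q"
    "Vector_Spaces.linear sA (*) \<eta>" "Vector_Spaces.linear sA sA S"
    "Vector_Spaces.linear sA sA T" "Vector_Spaces.linear sA sA D"
  using assms by simp_all

lemma gd_flag_data_linear: "t \<in> gd_flag_data sA circ br \<Longrightarrow> linear_flag sA t"
  by (cases t) (auto simp: gd_flag_data_def novikov_flag_datum_def twisted_derivation_def)

text \<open>\<open>m a s\<close> stands for the vector \<open>a + s x\<close>.\<close>

locale flag_coordinates = gd_bialgebra sA circ br + E: vector_space sE
  for sA :: "'k::field \<Rightarrow> 'a::ab_group_add \<Rightarrow> 'a" and circ br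
    and sE :: "'k \<Rightarrow> 'e::ab_group_add \<Rightarrow> 'e" +
  fixes m :: "'a \<Rightarrow> 'k \<Rightarrow> 'e"
  assumes m_add: "m a s + m b r = m (a + b) (s + r)"
    and m_scale: "sE c (m a s) = m (sA c a) (c * s)"
    and m_eq [simp]: "m a s = m b r \<longleftrightarrow> a = b \<and> s = r"
    and m_surj: "\<exists>a s. u = m a s"
begin

lemma m_0 [simp]: "m 0 0 = 0"
  using m_add[of 0 0 0 0] by simp

lemma m_eq_0 [simp]: "m a s = 0 \<longleftrightarrow> a = 0 \<and> s = 0"
  unfolding m_0[symmetric] m_eq ..

lemma m_minus: "- m a s = m (- a) (- s)"
  by (rule minus_unique) (simp add: m_add)

lemma m_diff: "m a s - m b r = m (a - b) (s - r)"
  by (simp only: diff_conv_add_uminus m_minus m_add)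

lemmas m_arith = m_add m_minus m_diff m_scale

text \<open>The chosen pair exists by \<open>m_surj\<close> and is unique by \<open>m_eq\<close>;
  this inverse of the curried \<open>m\<close> lets operations on \<open>'e\<close> be defined by
  coordinate formulas.\<close>

definition coords :: "'e \<Rightarrow> 'a \<times> 'k" where
  "coords u = (SOME (a, s). u = m a s)"

lemma coords_m [simp]: "coords (m a s) = (a, s)"
  unfolding coords_def by (rule some_equality) auto

lemma linear_zero:
  assumes "Vector_Spaces.linear sE sE F" and "\<And>a. F (m a 0) = 0" "F (m 0 1) = 0"
  shows "F u = 0"
proof -
  obtain a s where "u = m a s" using m_surj by blast
  also have "\<dots> = m a 0 + sE s (m 0 1)" by (simp add: m_arith)
  finally show ?thesis by (simp add: linear_mapD[OF assms(1)] assms)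
qed

definition trilinear :: "('e \<Rightarrow> 'e \<Rightarrow> 'e \<Rightarrow> 'e) \<Rightarrow> bool" where
  "trilinear F \<longleftrightarrow> (\<forall>v w. Vector_Spaces.linear sE sE (\<lambda>u. F u v w)) \<and>
     (\<forall>u w. Vector_Spaces.linear sE sE (\<lambda>v. F u v w)) \<and>
     (\<forall>u v. Vector_Spaces.linear sE sE (\<lambda>w. F u v w))"

text \<open>Every vector combines an element of A with the basis vector \<open>m 0 1\<close>, so
  \<open>linear_zero\<close> disposes of the last argument, then the middle, then the first. Applied
  to the difference of the two sides of an identity, this leaves eight cases on generators.\<close>

lemma trilinear_zero:
  assumes "trilinear F"
    and "\<And>a b c. F (m a 0) (m b 0) (m c 0) = 0"
    and "\<And>a b. F (m a 0) (m b 0) (m 0 1) = 0"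
    and "\<And>a c. F (m a 0) (m 0 1) (m c 0) = 0"
    and "\<And>b c. F (m 0 1) (m b 0) (m c 0) = 0"
    and "\<And>a. F (m a 0) (m 0 1) (m 0 1) = 0"
    and "\<And>b. F (m 0 1) (m b 0) (m 0 1) = 0"
    and "\<And>c. F (m 0 1) (m 0 1) (m c 0) = 0"
    and "F (m 0 1) (m 0 1) (m 0 1) = 0"
  shows "F u v w = 0"
proof -
  have 1: "Vector_Spaces.linear sE sE (\<lambda>u. F u v w)" "Vector_Spaces.linear sE sE (\<lambda>v. F u v w)"
    "Vector_Spaces.linear sE sE (F u v)" for u v w
    using assms(1) by (auto simp: trilinear_def)
  have 2: "F (m a 0) (m b 0) w = 0" "F (m a 0) (m 0 1) w = 0" "F (m 0 1) (m b 0) w = 0"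
    "F (m 0 1) (m 0 1) w = 0" for a b w
    by (rule linear_zero[OF 1(3)]; rule assms)+
  have 3: "F (m a 0) v w = 0" "F (m 0 1) v w = 0" for a v w
    by (rule linear_zero[OF 1(2)]; rule 2)+
  show ?thesis
    by (rule linear_zero[OF 1(1)]; rule 3)
qed

section \<open>The product and bracket attached to a flag tuple\<close>

fun fcirc :: "('k, 'a) flag_datum \<Rightarrow> 'e \<Rightarrow> 'e \<Rightarrow> 'e" where
  "fcirc (p, q, S, T, a1, k, \<eta>, D) u w = (let (a, s) = coords u; (b, r) = coords w in
     m (circ a b + sA s (S b) + sA r (T a) + sA (s * r) a1) (s * r * k + p a * r + q b * s))"

text \<open>\<open>fcirc\<close> and \<open>fbr\<close> are the unified product in coordinates, for
  an arbitrary tuple: the flag axioms enter only as the condition for the identities to hold. No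
  \<open>s * r\<close> term occurs here, since the bracket of the basis vector with itself
  vanishes.\<close>

fun fbr :: "('k, 'a) flag_datum \<Rightarrow> 'e \<Rightarrow> 'e \<Rightarrow> 'e" where
  "fbr (p, q, S, T, a1, k, \<eta>, D) u w = (let (a, s) = coords u; (b, r) = coords w in
     m (br a b + sA s (D b) - sA r (D a)) (s * \<eta> b - r * \<eta> a))"

lemma fcirc_m: "fcirc (p, q, S, T, a1, k, \<eta>, D) (m a s) (m b r) =
    m (circ a b + sA s (S b) + sA r (T a) + sA (s * r) a1) (s * r * k + p a * r + q b * s)"
  by simp

lemma fbr_m: "fbr (p, q, S, T, a1, k, \<eta>, D) (m a s) (m b r) =
    m (br a b + sA s (D b) - sA r (D a)) (s * \<eta> b - r * \<eta> a)"
  by simp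

declare fcirc.simps [simp del] fbr.simps [simp del]

lemma flag_bilinear:
  assumes "linear_flag sA t"
  shows "bilinear_map sE sE sE (fcirc t)" "bilinear_map sE sE sE (fbr t)"
proof -
  obtain p q S T a1 k \<eta> D where t: "t = (p, q, S, T, a1, k, \<eta>, D)" by (rule flag_cases)
  note lin = linear_flagD[OF assms[unfolded t]]
  note L = lin[THEN linear_mapD(1)] lin[THEN linear_mapD(2)]
  show "bilinear_map sE sE sE (fcirc t)"
  proof (rule bilinear_mapI)
    fix u u' w c
    obtain a s a' s' b r where *: "u = m a s" "u' = m a' s'" "w = m b r" using m_surj by metis
    show "fcirc t (u + u') w = fcirc t u w + fcirc t u' w"
      "fcirc t w (u + u') = fcirc t w u + fcirc t w u'"
      "fcirc t (sE c u) w = sE c (fcirc t u w)" "fcirc t w (sE c u) = sE c (fcirc t w u)"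
      unfolding * t by (simp_all add: m_arith fcirc_m L circ_lin algebra_simps)
  qed (fact E.vector_space_axioms)+
  show "bilinear_map sE sE sE (fbr t)"
  proof (rule bilinear_mapI)
    fix u u' w c
    obtain a s a' s' b r where *: "u = m a s" "u' = m a' s'" "w = m b r" using m_surj by metis
    show "fbr t (u + u') w = fbr t u w + fbr t u' w"
      "fbr t w (u + u') = fbr t w u + fbr t w u'"
      "fbr t (sE c u) w = sE c (fbr t u w)" "fbr t w (sE c u) = sE c (fbr t w u)"
      unfolding * t by (simp_all add: m_arith fbr_m L br_lin algebra_simps)
  qed (fact E.vector_space_axioms)+
qed

section \<open>Bialgebra identities versus flag datum axioms\<close>

lemma flag_datum_of_gd:
  assumes lin: "linear_flag sA t" and gd: "gd_bialgebra sE (fcirc t) (fbr t)"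
  shows "t \<in> gd_flag_data sA circ br"
proof -
  obtain p q S T a1 k \<eta> D where t: "t = (p, q, S, T, a1, k, \<eta>, D)" by (rule flag_cases)
  note lins = linear_flagD[OF lin[unfolded t]]
  note L = lins[THEN linear_mapD(1)] lins[THEN linear_mapD(2)] lins[THEN linear_mapD(3)]
    lins[THEN linear_mapD(4)] lins[THEN linear_mapD(5)]
  interpret X: gd_bialgebra sE "fcirc t" "fbr t" by fact
  \<comment> \<open>\<open>m 0 0\<close> simplifies to 0, a form that \<open>fcirc_m\<close> and
    \<open>fbr_m\<close> do not match, so products with 0 need their own rules.\<close>
  note simps = t fcirc_m fbr_m m_arith L circ_lin br_lin br_self
    X.circ_lin(9,10)[unfolded t] X.br_lin(9,10)[unfolded t]
  \<comment> \<open>In the names, L, R, J, G stand for left symmetry, right commutativity, Jacobi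
    and compatibility; the letters after L, R, G give the arguments, X being \<open>m 0 1\<close>
    and A or B an element of A. The A-component and the coordinate along \<open>m 0 1\<close> give
    in turn: (FN3) with half of (FN1); (FN2) with the other half; (FN4), (FN5); (FN7), (FN8); (FN6);
    (FN9), (FN10); the twisted derivation; (GF1), (GF2); (GF3), (GF4); (GF5), (GF6).\<close>
  have LAAX: "T (circ a b) - T (circ b a) = sA (p b) (T a) - sA (p a) (T b) + circ a (T b) - circ b (T a)
     \<and> p (circ a b) = p (circ b a)" for a b
    using X.circ_left_symmetric[of "m a 0" "m b 0" "m 0 1"] by (simp add: simps algebra_simps)
  have LAXA: "S (circ a b) = circ (S a) b + circ a (S b) + sA (q a - p a) (S b) + sA (q b) (T a)
         - circ (T a) b \<and> q (circ a b) = q a * q b" for a b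
    using X.circ_left_symmetric[of "m a 0" "m 0 1" "m b 0"] by (auto simp add: simps algebra_simps)
  have LAXX: "T (T a) = T (S a) - S (T a) + circ a a1 + sA (q a - 2 * p a) a1 + sA k (T a)
     \<and> p (S a) - p (T a) = q (T a) + k * (p a - q a)" for a 
    using X.circ_left_symmetric[of "m a 0" "m 0 1" "m 0 1"] by (auto simp add: simps scale_twice algebra_simps)
  have RAAX: "T (circ a b) = circ (T a) b + sA (p a) (S b) \<and> p (circ a b) = p a * q b" for a b
    using X.circ_right_commute[of "m a 0" "m b 0" "m 0 1"] by (simp add: simps algebra_simps)
  have RXAB: "circ (S a) b + sA (q a) (S b) = circ (S b) a + sA (q b) (S a)" for a b
    using X.circ_right_commute[of "m 0 1" "m a 0" "m b 0"] by (simp add: simps algebra_simps)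
  have RXAX: "T (S a) = circ a1 a + sA k (S a) - sA (q a) a1 \<and> p (S a) = 0" for a
    using X.circ_right_commute[of "m 0 1" "m a 0" "m 0 1"] by (simp add: simps algebra_simps)
  have J: "\<eta> (br a b) = 0 \<and>
       D (br a b) = br (D a) b + br a (D b) + sA (\<eta> a) (D b) - sA (\<eta> b) (D a)" for a b
    using X.br_jacobi[of "m 0 1" "m a 0" "m b 0"] by (simp add: simps br_skew[of b "D a"] algebra_simps)
  have GAAX: "br a (T b) - sA (p b) (D a) - D (circ b a) + T (br b a) + circ (D b) a + sA (\<eta> b) (S a)
         + circ b (D a) + sA (\<eta> a) (T b) = 0 \<and>
       p (br b a) + \<eta> b * q a - \<eta> (circ b a) = 0" for a b
    using X.gd_compat[of "m a 0" "m b 0" "m 0 1"] by (auto simp add: simps algebra_simps)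
  have GAXA: "br a (S b) - sA (q b) (D a) - br b (S a) + sA (q a) (D b) + circ (D a) b + sA (\<eta> a) (S b)
         - circ (D b) a - sA (\<eta> b) (S a) - S (br a b) = 0 \<and>
       q (br a b) = 0" for a b
    using X.gd_compat[of "m a 0" "m 0 1" "m b 0"] by (auto simp add: simps algebra_simps)
  have GAXX: "br a a1 - sA k (D a) - D (S a) + T (D a) + sA (2 * \<eta> a) a1 + S (D a) = 0 \<and>
       k * \<eta> a - \<eta> (S a) + p (D a) + q (D a) = 0" for a
    using X.gd_compat[of "m a 0" "m 0 1" "m 0 1"] by (auto simp add: simps scale_twice algebra_simps)
  show ?thesis
    unfolding t gd_flag_data_def novikov_flag_datum_def twisted_derivation_def
    using lins LAAX LAXA LAXX RAAX RXAB RXAX J GAAX GAXA GAXX by simp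
qed

text \<open>On generators the components of each identity are flag axioms or identities of A. The
  cases left to the closing simplification cancel by symmetry: equal first two arguments for left
  symmetry, equal last two for right commutativity, at least two copies of \<open>m 0 1\<close> for
  Jacobi, equal outer arguments for compatibility.\<close>

lemma gd_of_flag_datum:
  assumes tF: "t \<in> gd_flag_data sA circ br"
  shows "gd_bialgebra sE (fcirc t) (fbr t)"
proof -
  obtain p q S T a1 k \<eta> D where t: "t = (p, q, S, T, a1, k, \<eta>, D)" by (rule flag_cases)
  have lin: "linear_flag sA t" using tF by (rule gd_flag_data_linear)
  note lins = linear_flagD[OF lin[unfolded t]]
  note L = lins[THEN linear_mapD(1)] lins[THEN linear_mapD(2)] lins[THEN linear_mapD(3)]
    lins[THEN linear_mapD(4)] lins[THEN linear_mapD(5)]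
  note B = bilinear_mapD[OF flag_bilinear(1)[OF lin]] bilinear_mapD[OF flag_bilinear(2)[OF lin]]
  have F: "novikov_flag_datum sA circ p q S T a1 k" "twisted_derivation sA br \<eta> D"
    using tF unfolding t gd_flag_data_def mem_Collect_eq prod.case by iprover+
  have LAAX: "T (circ a b) - T (circ b a) = sA (p b) (T a) - sA (p a) (T b) + circ a (T b) - circ b (T a)"
     "p (circ a b) = p (circ b a)" for a b
    using F(1) unfolding novikov_flag_datum_def by iprover+
  have LAXA: "S (circ a b) = circ (S a) b + circ a (S b) + sA (q a - p a) (S b) + sA (q b) (T a)
         - circ (T a) b" "q (circ a b) = q a * q b" for a b
    using F(1) unfolding novikov_flag_datum_def by iprover+
  have LAXX: "T (T a) = T (S a) - S (T a) + circ a a1 + sA (q a - 2 * p a) a1 + sA k (T a)"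
     "p (S a) - p (T a) = q (T a) + k * (p a - q a)" for a
    using F(1) unfolding novikov_flag_datum_def by iprover+
  have RAAX: "T (circ a b) = circ (T a) b + sA (p a) (S b)" "p (circ a b) = p a * q b" for a b
    using F(1) unfolding novikov_flag_datum_def by iprover+
  have RXAB: "circ (S a) b + sA (q a) (S b) = circ (S b) a + sA (q b) (S a)" for a b
    using F(1) unfolding novikov_flag_datum_def by iprover
  have RXAX: "T (S a) = circ a1 a + sA k (S a) - sA (q a) a1" "p (S a) = 0" for a
    using F(1) unfolding novikov_flag_datum_def by iprover+
  have J: "\<eta> (br a b) = 0"
       "D (br a b) = br (D a) b + br a (D b) + sA (\<eta> a) (D b) - sA (\<eta> b) (D a)" for a b
    using F(2) unfolding twisted_derivation_def by iprover+
  have GAAX: "br a (T b) - sA (p b) (D a) - D (circ b a) + T (br b a) + circ (D b) a + sA (\<eta> b) (S a)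
         + circ b (D a) + sA (\<eta> a) (T b) = 0"
       "p (br b a) + \<eta> b * q a - \<eta> (circ b a) = 0" for a b
    using tF unfolding t gd_flag_data_def mem_Collect_eq prod.case by iprover+
  have GAXA: "br a (S b) - sA (q b) (D a) - br b (S a) + sA (q a) (D b) + circ (D a) b + sA (\<eta> a) (S b)
         - circ (D b) a - sA (\<eta> b) (S a) - S (br a b) = 0"
       "q (br a b) = 0" for a b
    using tF unfolding t gd_flag_data_def mem_Collect_eq prod.case by iprover+
  have GAXX: "br a a1 - sA k (D a) - D (S a) + T (D a) + sA (2 * \<eta> a) a1 + S (D a) = 0"
       "k * \<eta> a - \<eta> (S a) + p (D a) + q (D a) = 0" for a
    using tF unfolding t gd_flag_data_def mem_Collect_eq prod.case by iprover+
  note simps = t fcirc_m fbr_m m_arith L circ_lin br_lin br_self B(9,10,19,20)[unfolded t]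
  have left: "fcirc t (fcirc t u v) w - fcirc t u (fcirc t v w)
      - (fcirc t (fcirc t v u) w - fcirc t v (fcirc t u w)) = 0" (is "?F u v w = 0") for u v w
  proof (rule trilinear_zero[of ?F])
    show "trilinear ?F"
      unfolding trilinear_def Vector_Spaces.linear_iff
      by (simp add: B E.vector_space_axioms algebra_simps)
    show "?F (m a 0) (m b 0) (m c 0) = 0" for a b c
      using circ_left_symmetric[of a b c] by (simp add: simps algebra_simps)
    show "?F (m a 0) (m b 0) (m 0 1) = 0" for a b
      using LAAX[of a b] by (simp add: simps algebra_simps)
    show "?F (m a 0) (m 0 1) (m b 0) = 0" for a b
      using LAXA[of a b] by (simp add: simps algebra_simps)
    show "?F (m 0 1) (m a 0) (m b 0) = 0" for a b
      using LAXA[of a b] by (simp add: simps algebra_simps)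
    show *: "?F (m a 0) (m 0 1) (m 0 1) = 0" for a
      using LAXX[of a] by (simp add: simps scale_twice algebra_simps)
    \<comment> \<open>Left symmetry is antisymmetric in its first two arguments, so this is the
      preceding case with its two sides exchanged.\<close>
    show "?F (m 0 1) (m a 0) (m 0 1) = 0" for a
      using *[of a] unfolding right_minus_eq by (rule sym)
  qed simp_all
  have right: "fcirc t (fcirc t u v) w - fcirc t (fcirc t u w) v = 0" (is "?F u v w = 0") for u v w
  proof (rule trilinear_zero[of ?F])
    show "trilinear ?F"
      unfolding trilinear_def Vector_Spaces.linear_iff
      by (simp add: B E.vector_space_axioms algebra_simps)
    show "?F (m a 0) (m b 0) (m c 0) = 0" for a b c
      using circ_right_commute[of a b c] by (simp add: simps algebra_simps)
    show "?F (m a 0) (m b 0) (m 0 1) = 0" for a b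
      using RAAX[of a b] by (simp add: simps algebra_simps)
    show "?F (m a 0) (m 0 1) (m b 0) = 0" for a b
      using RAAX[of a b] by (simp add: simps algebra_simps)
    show "?F (m 0 1) (m a 0) (m b 0) = 0" for a b
      using RXAB[of a b] by (simp add: simps algebra_simps)
    show "?F (m 0 1) (m a 0) (m 0 1) = 0" for a
      using RXAX[of a] by (simp add: simps algebra_simps)
    show "?F (m 0 1) (m 0 1) (m a 0) = 0" for a
      using RXAX[of a] by (simp add: simps algebra_simps)
  qed simp_all
  have jacobi: "fbr t u (fbr t v w) + fbr t v (fbr t w u) + fbr t w (fbr t u v) = 0"
    (is "?F u v w = 0") for u v w
  proof (rule trilinear_zero[of ?F])
    show "trilinear ?F"
      unfolding trilinear_def Vector_Spaces.linear_iff
      by (simp add: B E.vector_space_axioms algebra_simps)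
    show "?F (m a 0) (m b 0) (m c 0) = 0" for a b c
      using br_jacobi[of a b c] by (simp add: simps algebra_simps)
    show "?F (m a 0) (m b 0) (m 0 1) = 0" for a b
      using J[of a b] by (simp add: simps br_skew[of b "D a"] algebra_simps)
    show "?F (m a 0) (m 0 1) (m b 0) = 0" for a b
      using J[of b a] by (simp add: simps br_skew[of a "D b"] algebra_simps)
    show "?F (m 0 1) (m a 0) (m b 0) = 0" for a b
      using J[of a b] by (simp add: simps br_skew[of b "D a"] algebra_simps)
  qed (simp_all add: simps algebra_simps)
  have compat: "fbr t u (fcirc t v w) - fbr t w (fcirc t v u) + fcirc t (fbr t v u) w
      - fcirc t (fbr t v w) u - fcirc t v (fbr t u w) = 0" (is "?F u v w = 0") for u v w
  proof (rule trilinear_zero[of ?F])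
    show "trilinear ?F"
      unfolding trilinear_def Vector_Spaces.linear_iff
      by (simp add: B E.vector_space_axioms algebra_simps)
    show "?F (m a 0) (m b 0) (m c 0) = 0" for a b c
      using gd_compat[of a b c] by (simp add: simps algebra_simps)
    show "?F (m a 0) (m b 0) (m 0 1) = 0" for a b
      using GAAX[where a=a and b=b] by (simp add: simps algebra_simps)
    show "?F (m a 0) (m 0 1) (m b 0) = 0" for a b
    proof -
      \<comment> \<open>The axioms here equate long sums with 0. Both components are therefore
        written literally as the left sides of (GF3) and (GF4), the latter with a sign, so that
        rewriting collapses them.\<close>
      have "?F (m a 0) (m 0 1) (m b 0) = m (br a (S b) - sA (q b) (D a) - br b (S a) + sA (q a) (D b)
          + circ (D a) b + sA (\<eta> a) (S b) - circ (D b) a - sA (\<eta> b) (S a) - S (br a b)) (- q (br a b))"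
        by (simp add: simps algebra_simps)
      then show ?thesis by (simp only: GAXA) simp
    qed
    \<comment> \<open>Exchanging the outer arguments changes the sign of the compatibility
      expression, so the same axioms serve again; the last case below is likewise the negative of
      the one before it.\<close>
    show "?F (m 0 1) (m b 0) (m a 0) = 0" for a b
      using GAAX[where a=a and b=b] by (simp add: simps algebra_simps)
    show "?F (m a 0) (m 0 1) (m 0 1) = 0" for a
    proof -
      have "?F (m a 0) (m 0 1) (m 0 1) = m (br a a1 - sA k (D a) - D (S a) + T (D a) + sA (2 * \<eta> a) a1 + S (D a))
          (k * \<eta> a - \<eta> (S a) + p (D a) + q (D a))"
        by (simp add: simps scale_twice algebra_simps)
      then show ?thesis by (simp only: GAXX) simp
    qed
    show "?F (m 0 1) (m 0 1) (m a 0) = 0" for a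
    proof -
      have "?F (m 0 1) (m 0 1) (m a 0) = m (- (br a a1 - sA k (D a) - D (S a) + T (D a) + sA (2 * \<eta> a) a1 + S (D a)))
          (- (k * \<eta> a - \<eta> (S a) + p (D a) + q (D a)))"
        by (simp add: simps scale_twice algebra_simps)
      then show ?thesis by (simp only: GAXX) simp
    qed
  qed (simp_all add: simps algebra_simps)
  show ?thesis
  proof (intro gd_bialgebra.intro novikov_algebra.intro lie_algebra.intro novikov_algebra_axioms.intro
      lie_algebra_axioms.intro gd_bialgebra_axioms.intro)
    show "fbr t u u = 0" for u
    proof -
      obtain a s where "u = m a s" using m_surj by iprover
      then show ?thesis by (simp add: simps)
    qed
  qed (rule left[unfolded right_minus_eq] right[unfolded right_minus_eq] jacobi compat
      flag_bilinear[OF lin] E.vector_space_axioms)+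
qed

section \<open>Structures containing A correspond to flag data\<close>

lemma flag_ext_structure:
  assumes tF: "t \<in> gd_flag_data sA circ br"
  shows "(fcirc t, fbr t) \<in> ext_structures sE sA circ br (\<lambda>a. m a 0)"
proof -
  obtain p q S T a1 k \<eta> D where t: "t = (p, q, S, T, a1, k, \<eta>, D)" by (rule flag_cases)
  show ?thesis
    unfolding ext_structures_def gd_hom_def Vector_Spaces.linear_iff
    using gd_of_flag_datum[OF tF]
    by (simp add: t fcirc_m fbr_m m_arith vector_space_axioms E.vector_space_axioms)
qed

text \<open>Every entry of the tuple is a coordinate of a product of \<open>m 0 1\<close> with A or
  with itself, or of its bracket with A.\<close>

lemma flag_structure_inj:
  assumes "linear_flag sA t" "linear_flag sA t'" "fcirc t = fcirc t'" "fbr t = fbr t'"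
  shows "t = t'"
proof -
  obtain p q S T a1 k \<eta> D where t: "t = (p, q, S, T, a1, k, \<eta>, D)" by (rule flag_cases)
  obtain p' q' S' T' a1' k' \<eta>' D' where t': "t' = (p', q', S', T', a1', k', \<eta>', D')"
    by (rule flag_cases)
  note L = assms(1,2)[unfolded t t' linear_flag.simps]
  have c: "fcirc t u w = fcirc t' u w" and b: "fbr t u w = fbr t' u w" for u w
    using assms by simp_all
  \<comment> \<open>Evaluating the general formulas at generators leaves entries at 0, which must
    vanish before the others can be compared.\<close>
  have z: "p 0 = 0" "q 0 = 0" "S 0 = 0" "T 0 = 0" "p' 0 = 0" "q' 0 = 0" "S' 0 = 0" "T' 0 = 0"
    "\<eta> 0 = 0" "\<eta>' 0 = 0" "D 0 = 0" "D' 0 = 0"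
    using L by (blast dest: linear_mapD(5))+
  show ?thesis
    using c[of "m _ 0" "m 0 1"] c[of "m 0 1" "m _ 0"] c[of "m 0 1" "m 0 1"] b[of "m 0 1" "m _ 0"]
    unfolding t t' by (auto simp: fcirc_m fbr_m z circ_lin br_lin)
qed

text \<open>The tuple is read off the products with \<open>m 0 1\<close>; bilinearity then forces
  the operations to be \<open>fcirc\<close> and \<open>fbr\<close> of that tuple. The flag axioms
  follow from \<open>flag_datum_of_gd\<close>, the given structure being a bialgebra. In the proof,
  \<open>x\<close> and \<open>y\<close> range over A.\<close>

lemma ext_structure_flag:
  assumes "(c, b) \<in> ext_structures sE sA circ br (\<lambda>a. m a 0)"
  obtains t where "t \<in> gd_flag_data sA circ br" "c = fcirc t" "b = fbr t"
proof -
  from assms interpret X: gd_bialgebra sE c b by (simp add: ext_structures_def)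
  from assms have hom: "c (m x 0) (m y 0) = m (circ x y) 0" "b (m x 0) (m y 0) = m (br x y) 0" for x y
    by (simp_all add: ext_structures_def gd_hom_def)
  define p where "p x = snd (coords (c (m x 0) (m 0 1)))" for x
  define T where "T x = fst (coords (c (m x 0) (m 0 1)))" for x
  define q where "q x = snd (coords (c (m 0 1) (m x 0)))" for x
  define S where "S x = fst (coords (c (m 0 1) (m x 0)))" for x
  define k where "k = snd (coords (c (m 0 1) (m 0 1)))"
  define a1 where "a1 = fst (coords (c (m 0 1) (m 0 1)))"
  define \<eta> where "\<eta> x = snd (coords (b (m 0 1) (m x 0)))" for x
  define D where "D x = fst (coords (b (m 0 1) (m x 0)))" for x
  have m_coords: "m (fst (coords u)) (snd (coords u)) = u" for u
    using m_surj[of u] by auto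
  have gens: "c (m x 0) (m 0 1) = m (T x) (p x)" "c (m 0 1) (m x 0) = m (S x) (q x)"
    "c (m 0 1) (m 0 1) = m a1 k" "b (m 0 1) (m x 0) = m (D x) (\<eta> x)" for x
    by (simp_all add: p_def T_def q_def S_def k_def a1_def \<eta>_def D_def m_coords)
  have add: "m (x + y) 0 = m x 0 + m y 0" and scale: "m (sA r x) 0 = sE r (m x 0)" for x y r
    by (simp_all add: m_arith)
  \<comment> \<open>Both coordinates are treated at once: an equality of \<open>m\<close>-vectors
    splits by \<open>m_eq\<close> into the laws for the A-valued and the scalar map.\<close>
  have "m (T (x + y)) (p (x + y)) = m (T x + T y) (p x + p y)"
    "m (S (x + y)) (q (x + y)) = m (S x + S y) (q x + q y)"
    "m (D (x + y)) (\<eta> (x + y)) = m (D x + D y) (\<eta> x + \<eta> y)"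
    "m (T (sA r x)) (p (sA r x)) = m (sA r (T x)) (r * p x)"
    "m (S (sA r x)) (q (sA r x)) = m (sA r (S x)) (r * q x)"
    "m (D (sA r x)) (\<eta> (sA r x)) = m (sA r (D x)) (r * \<eta> x)" for x y r
    by (simp_all only: gens[symmetric] add scale X.circ_lin X.br_lin)
      (simp_all only: gens m_arith)
  then have lin: "linear_flag sA (p, q, S, T, a1, k, \<eta>, D)"
    by (simp add: Vector_Spaces.linear_iff vector_space_axioms vector_space_field)
  \<comment> \<open>The tuple records only the bracket with \<open>m 0 1\<close> on the left; skew
    symmetry supplies the other order.\<close>
  have b_gen: "b (m x 0) (m 0 1) = m (- D x) (- \<eta> x)" for x
    using X.br_skew[where a="m 0 1" and b="m x 0"] by (simp add: gens m_arith)
  have "c (m x s) (m y r) = fcirc (p, q, S, T, a1, k, \<eta>, D) (m x s) (m y r)"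
    and "b (m x s) (m y r) = fbr (p, q, S, T, a1, k, \<eta>, D) (m x s) (m y r)" for x s y r
  proof -
    have *: "m x s = m x 0 + sE s (m 0 1)" "m y r = m y 0 + sE r (m 0 1)"
      by (simp_all add: m_arith)
    have "c (m x s) (m y r) = m (circ x y) 0 + sE r (m (T x) (p x)) + sE s (m (S y) (q y))
        + sE s (sE r (m a1 k))"
      unfolding * by (simp add: X.circ_lin hom gens algebra_simps)
    then show "c (m x s) (m y r) = fcirc (p, q, S, T, a1, k, \<eta>, D) (m x s) (m y r)"
      by (simp add: fcirc_m m_arith algebra_simps)
    have "b (m x s) (m y r) = m (br x y) 0 + sE r (m (- D x) (- \<eta> x)) + sE s (m (D y) (\<eta> y))"
      unfolding * by (simp add: X.br_lin X.br_self hom gens b_gen algebra_simps)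
    then show "b (m x s) (m y r) = fbr (p, q, S, T, a1, k, \<eta>, D) (m x s) (m y r)"
      by (simp add: fbr_m m_arith algebra_simps)
  qed
  then have cb: "c u w = fcirc (p, q, S, T, a1, k, \<eta>, D) u w"
    "b u w = fbr (p, q, S, T, a1, k, \<eta>, D) u w" for u w
    using m_surj[of u] m_surj[of w] by auto
  then have cb': "c = fcirc (p, q, S, T, a1, k, \<eta>, D)" "b = fbr (p, q, S, T, a1, k, \<eta>, D)"
    by blast+
  from flag_datum_of_gd[OF lin] X.gd_bialgebra_axioms cb' that show thesis by metis
qed

section \<open>Isomorphisms fixing A and the relations (FD1)-(FD5)\<close>

lemma ext_iso_flag:
  assumes "t \<in> gd_flag_data sA circ br" "t' \<in> gd_flag_data sA circ br"
  shows "((fcirc t, fbr t), (fcirc t', fbr t')) \<in> ext_iso sE sA circ br (\<lambda>a. m a 0) \<longleftrightarrow>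
    (t, t') \<in> gd_flag_equiv sA circ br"
proof -
  obtain p q S T a1 k \<eta> D where t: "t = (p, q, S, T, a1, k, \<eta>, D)" by (rule flag_cases)
  obtain p' q' S' T' a1' k' \<eta>' D' where t': "t' = (p', q', S', T', a1', k', \<eta>', D')"
    by (rule flag_cases)
  note lins = linear_flagD[OF gd_flag_data_linear[OF assms(1)[unfolded t]]]
    linear_flagD[OF gd_flag_data_linear[OF assms(2)[unfolded t']]]
  note L = lins[THEN linear_mapD(1)] lins[THEN linear_mapD(2)] lins[THEN linear_mapD(3)]
    lins[THEN linear_mapD(4)] lins[THEN linear_mapD(5)]
  note simps = t t' fcirc_m fbr_m m_arith L circ_lin br_lin br_self
  show ?thesis
  proof
    assume "((fcirc t, fbr t), (fcirc t', fbr t')) \<in> ext_iso sE sA circ br (\<lambda>a. m a 0)"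
    then obtain \<phi> where hom: "gd_hom sE (fcirc t) (fbr t) sE (fcirc t') (fbr t') \<phi>"
      and bij: "bij \<phi>" and fixA: "\<And>a. \<phi> (m a 0) = m a 0"
      unfolding ext_iso_def by blast
    obtain a0 \<beta> where x: "\<phi> (m 0 1) = m a0 \<beta>" using m_surj by blast
    \<comment> \<open>Otherwise \<open>m 0 1\<close> and \<open>m a0 0\<close> would have the same
      image, the latter being fixed.\<close>
    have "\<beta> \<noteq> 0"
    proof
      assume "\<beta> = 0"
      with x fixA have "\<phi> (m 0 1) = \<phi> (m a0 0)" by simp
      with bij have "m 0 1 = m a0 0" by (simp add: bij_def inj_eq)
      then show False by simp
    qed
    have lin: "Vector_Spaces.linear sE sE \<phi>" using hom by (simp add: gd_hom_def)
    have \<phi>: "\<phi> (m a s) = m (a + sA s a0) (s * \<beta>)" for a s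
    proof -
      have "\<phi> (m a s) = \<phi> (m a 0 + sE s (m 0 1))" by (simp add: m_arith)
      then show ?thesis by (simp only: linear_mapD[OF lin] fixA x) (simp add: m_arith)
    qed
    have c: "\<phi> (fcirc t u w) = fcirc t' (\<phi> u) (\<phi> w)" and b: "\<phi> (fbr t u w) = fbr t' (\<phi> u) (\<phi> w)" for u w
      using hom by (auto simp: gd_hom_def)
    \<comment> \<open>The coordinate along \<open>m 0 1\<close> carries a factor \<beta> on both
      sides. Cancelling it identifies p, q, \<eta> with their primed versions and, for the square of
      \<open>m 0 1\<close>, yields (FD4).\<close>
    have 1: "T a + sA (p a) a0 = circ a a0 + sA \<beta> (T' a)" "p a = p' a" for a
      using c[of "m a 0" "m 0 1"] \<open>\<beta> \<noteq> 0\<close> by (auto simp: simps \<phi>)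
    have 2: "S a + sA (q a) a0 = circ a0 a + sA \<beta> (S' a)" "q a = q' a" for a
      using c[of "m 0 1" "m a 0"] \<open>\<beta> \<noteq> 0\<close> by (auto simp: simps \<phi>)
    have 3: "D a + sA (\<eta> a) a0 = br a0 a + sA \<beta> (D' a)" "\<eta> a = \<eta>' a" for a
      using b[of "m 0 1" "m a 0"] \<open>\<beta> \<noteq> 0\<close> by (auto simp: simps \<phi>)
    have "a1 + sA k a0 = circ a0 a0 + sA \<beta> (S' a0) + sA \<beta> (T' a0) + sA (\<beta>\<^sup>2) a1'"
      "k * \<beta> = (\<beta> * k' + p a0 + q a0) * \<beta>"
      using c[of "m 0 1" "m 0 1"] by (auto simp: simps \<phi> 1(2) 2(2) power2_eq_square algebra_simps)
    then have "a1 = circ a0 a0 + sA \<beta> (S' a0) + sA \<beta> (T' a0) + sA (\<beta>\<^sup>2) a1' - sA k a0 \<and>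
            k = \<beta> * k' + p a0 + q a0"
      using \<open>\<beta> \<noteq> 0\<close> by (simp only: mult_cancel_right) (simp add: algebra_simps)
    moreover have "p = p'" "q = q'" "\<eta> = \<eta>'" using 1(2) 2(2) 3(2) by blast+
    moreover have "S a = circ a0 a + sA \<beta> (S' a) - sA (q a) a0 \<and>
            T a = circ a a0 + sA \<beta> (T' a) - sA (p a) a0 \<and> 
            D a = sA \<beta> (D' a) + br a0 a - sA (\<eta> a) a0" for a
      using 1(1)[of a] 2(1)[of a] 3(1)[of a] by (simp add: algebra_simps)
    ultimately show "(t, t') \<in> gd_flag_equiv sA circ br"
      using assms \<open>\<beta> \<noteq> 0\<close> unfolding gd_flag_equiv_def t t' by blast
  next
    assume "(t, t') \<in> gd_flag_equiv sA circ br"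
    then obtain a0 \<beta> where eqs: "p' = p" "q' = q" "\<eta>' = \<eta>" and "\<beta> \<noteq> 0"
      and FD: "\<And>a. S a = circ a0 a + sA \<beta> (S' a) - sA (q a) a0"
        "\<And>a. T a = circ a a0 + sA \<beta> (T' a) - sA (p a) a0"
        "a1 = circ a0 a0 + sA \<beta> (S' a0) + sA \<beta> (T' a0) + sA (\<beta>\<^sup>2) a1' - sA k a0"
        "k = \<beta> * k' + p a0 + q a0"
        "\<And>a. D a = sA \<beta> (D' a) + br a0 a - sA (\<eta> a) a0"
      unfolding gd_flag_equiv_def t t' by blast
    define \<phi> where "\<phi> u = (let (a, s) = coords u in m (a + sA s a0) (s * \<beta>))" for u
    have \<phi>: "\<phi> (m a s) = m (a + sA s a0) (s * \<beta>)" for a s by (simp add: \<phi>_def)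
    have "inj \<phi>"
    proof (rule injI)
      fix u w assume "\<phi> u = \<phi> w"
      then show "u = w" using m_surj[of u] m_surj[of w] \<open>\<beta> \<noteq> 0\<close> by (auto simp: \<phi>)
    qed
    moreover have "surj \<phi>"
    proof (rule surjI)
      \<comment> \<open>The preimage comes from solving \<open>b + r a0 = a\<close> and
        \<open>r \<beta> = s\<close> for b and r.\<close>
      show "\<phi> (let (a, s) = coords u in m (a - sA (s / \<beta>) a0) (s / \<beta>)) = u" for u
        using m_surj[of u] \<open>\<beta> \<noteq> 0\<close> by (auto simp: \<phi>)
    qed
    ultimately have "bij \<phi>" by (simp add: bij_def)
    moreover have "\<phi> (u + w) = \<phi> u + \<phi> w" "\<phi> (sE r u) = sE r (\<phi> u)"
      "\<phi> (fcirc t u w) = fcirc t' (\<phi> u) (\<phi> w)" "\<phi> (fbr t u w) = fbr t' (\<phi> u) (\<phi> w)" for u w r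
    proof -
      obtain a s b r' where u: "u = m a s" "w = m b r'" using m_surj by metis
      show "\<phi> (u + w) = \<phi> u + \<phi> w" "\<phi> (sE r u) = sE r (\<phi> u)"
        by (simp_all add: u \<phi> m_arith algebra_simps)
      show "\<phi> (fcirc t u w) = fcirc t' (\<phi> u) (\<phi> w)"
        \<comment> \<open>Coordinates are compared first; then (FD1)-(FD5) express the unprimed
          entries through the primed ones, and both sides agree.\<close>
        by (simp add: u \<phi> simps eqs) (simp add: FD power2_eq_square algebra_simps)
      show "\<phi> (fbr t u w) = fbr t' (\<phi> u) (\<phi> w)"
        by (simp add: u \<phi> simps eqs) (simp add: FD br_skew[where a=a0 and b=a] algebra_simps)
    qed
    moreover have "\<phi> (m a 0) = m a 0" for a by (simp add: \<phi>)
    ultimately show "((fcirc t, fbr t), (fcirc t', fbr t')) \<in> ext_iso sE sA circ br (\<lambda>a. m a 0)"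
      unfolding ext_iso_def gd_hom_def Vector_Spaces.linear_iff
      using assms[THEN flag_ext_structure] E.vector_space_axioms by auto
  qed
qed

end

section \<open>Equivalence relations and bijections between quotients\<close>

lemma equiv_ext_iso: "equiv (ext_structures sE sA circ br \<iota>) (ext_iso sE sA circ br \<iota>)"
proof (rule equivI)
  show "ext_iso sE sA circ br \<iota> \<subseteq> ext_structures sE sA circ br \<iota> \<times> ext_structures sE sA circ br \<iota>"
    by (auto simp: ext_iso_def)
  show "refl_on (ext_structures sE sA circ br \<iota>) (ext_iso sE sA circ br \<iota>)"
  proof (rule refl_onI)
    fix X assume X: "X \<in> ext_structures sE sA circ br \<iota>"
    obtain c b where [simp]: "X = (c, b)" by (cases X)
    interpret gd_bialgebra sE c b using X by (simp add: ext_structures_def)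
    have "gd_hom sE c b sE c b (\<lambda>u. u)" by (simp add: gd_hom_def linear_ident)
    then show "(X, X) \<in> ext_iso sE sA circ br \<iota>"
      using X bij_id[unfolded id_def] unfolding ext_iso_def by auto
  qed
  show "sym (ext_iso sE sA circ br \<iota>)"
  proof (rule symI)
    fix X Y assume "(X, Y) \<in> ext_iso sE sA circ br \<iota>"
    then obtain c b c' b' \<phi> where [simp]: "X = (c, b)" "Y = (c', b')"
      and mem: "X \<in> ext_structures sE sA circ br \<iota>" "Y \<in> ext_structures sE sA circ br \<iota>"
      and hom: "gd_hom sE c b sE c' b' \<phi>" and bij: "bij \<phi>" and fixed: "\<And>a. \<phi> (\<iota> a) = \<iota> a"
      unfolding ext_iso_def by auto
    have [simp]: "inv \<phi> (\<phi> u) = u" "\<phi> (inv \<phi> u) = u" for u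
      using bij by (simp_all add: bij_is_inj bij_is_surj surj_f_inv_f)
    have \<phi>: "vector_space sE" "\<phi> (u + w) = \<phi> u + \<phi> w" "\<phi> (sE r u) = sE r (\<phi> u)"
      "\<phi> (c u w) = c' (\<phi> u) (\<phi> w)" "\<phi> (b u w) = b' (\<phi> u) (\<phi> w)" for u w r
      using hom by (auto simp: gd_hom_def Vector_Spaces.linear_iff)
    have inv_eq: "inv \<phi> u = w" if "u = \<phi> w" for u w using that by simp
    have "gd_hom sE c' b' sE c b (inv \<phi>)"
      unfolding gd_hom_def Vector_Spaces.linear_iff
      by (intro conjI allI inv_eq) (simp_all add: \<phi>)
    moreover have "inv \<phi> (\<iota> a) = \<iota> a" for a by (rule inv_eq) (simp add: fixed)
    ultimately show "(Y, X) \<in> ext_iso sE sA circ br \<iota>"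
      using mem bij_imp_bij_inv[OF bij] unfolding ext_iso_def by auto
  qed
  show "trans (ext_iso sE sA circ br \<iota>)"
  proof (rule transI)
    fix X Y Z assume "(X, Y) \<in> ext_iso sE sA circ br \<iota>" "(Y, Z) \<in> ext_iso sE sA circ br \<iota>"
    then obtain c b c' b' c'' b'' \<phi> \<psi>
      where [simp]: "X = (c, b)" "Y = (c', b')" "Z = (c'', b'')"
      and mem: "X \<in> ext_structures sE sA circ br \<iota>" "Z \<in> ext_structures sE sA circ br \<iota>"
      and hom: "gd_hom sE c b sE c' b' \<phi>" "gd_hom sE c' b' sE c'' b'' \<psi>"
      and bij: "bij \<phi>" "bij \<psi>" and fixed: "\<And>a. \<phi> (\<iota> a) = \<iota> a" "\<And>a. \<psi> (\<iota> a) = \<iota> a"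
      unfolding ext_iso_def by auto
    have "gd_hom sE c b sE c'' b'' (\<psi> \<circ> \<phi>)"
      using hom by (auto simp: gd_hom_def Vector_Spaces.linear_iff)
    then show "(X, Z) \<in> ext_iso sE sA circ br \<iota>"
      using mem bij_comp[OF bij] fixed unfolding ext_iso_def by auto
  qed
qed

text \<open>Matching relations and surjectivity of f make the image of a class the class of the
  image. Injectivity of f passes to its image map on all subsets of A, among which are the
  classes.\<close>

lemma bij_betw_quotient:
  assumes f: "bij_betw f A B" and r: "r \<subseteq> A \<times> A" and s: "s \<subseteq> B \<times> B"
    and rs: "\<forall>x\<in>A. \<forall>y\<in>A. (f x, f y) \<in> s \<longleftrightarrow> (x, y) \<in> r"
  shows "bij_betw ((`) f) (A // r) (B // s)"
    and "x \<in> A \<Longrightarrow> f ` (r `` {x}) = s `` {f x}"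
proof -
  have B: "B = f ` A" using f by (simp add: bij_betw_def)
  show im: "f ` (r `` {x}) = s `` {f x}" if "x \<in> A" for x
    using that r s rs unfolding B by (auto simp: image_iff) blast+
  have "inj_on ((`) f) (A // r)"
  proof (rule inj_on_subset)
    show "inj_on ((`) f) (Pow A)" using f by (auto simp: bij_betw_def intro: inj_on_image_Pow)
    show "A // r \<subseteq> Pow A" using r by (auto simp: quotient_def)
  qed
  moreover have "(`) f ` (A // r) = B // s"
    unfolding quotient_def B by (auto simp: im image_iff)
  ultimately show "bij_betw ((`) f) (A // r) (B // s)" by (simp add: bij_betw_def)
qed

text \<open>Reflexivity, symmetry and transitivity pull back along f. Thus the flag relation
  inherits them from isomorphism of structures, without composing or inverting the pairs
  \<open>(a0, \<beta>)\<close>.\<close>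

lemma equiv_of_embedding:
  assumes "equiv B s" and r: "r \<subseteq> A \<times> A" and f: "f ` A \<subseteq> B"
    and rs: "\<And>x y. x \<in> A \<Longrightarrow> y \<in> A \<Longrightarrow> (f x, f y) \<in> s \<longleftrightarrow> (x, y) \<in> r"
  shows "equiv A r"
proof (rule equivI)
  show "r \<subseteq> A \<times> A" by (rule r)
  show "refl_on A r"
  proof (rule refl_onI)
    fix x assume "x \<in> A"
    with assms(1) f rs[of x x] show "(x, x) \<in> r" by (auto simp: equiv_def refl_on_def)
  qed
  show "sym r" using assms(1) r rs unfolding equiv_def sym_def by blast
  show "trans r"
  proof (rule transI)
    fix x y z assume "(x, y) \<in> r" "(y, z) \<in> r"
    moreover from this r have "x \<in> A" "y \<in> A" "z \<in> A" by auto
    ultimately show "(x, z) \<in> r"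
      using assms(1) rs[of x y] rs[of y z] rs[of x z] unfolding equiv_def trans_def by blast
  qed
qed

section \<open>Extending data of A by a line V\<close>

lemma ext_datum_zero:
  assumes "is_ext_datum sA sV \<Omega>"
  shows "lA \<Omega> 0 v = 0" "lA \<Omega> a 0 = 0" "rA \<Omega> 0 v = 0" "rA \<Omega> a 0 = 0"
    "lV \<Omega> 0 a = 0" "lV \<Omega> v 0 = 0" "rV \<Omega> 0 a = 0" "rV \<Omega> v 0 = 0"
    "fV \<Omega> 0 v = 0" "fV \<Omega> v 0 = 0" "starV \<Omega> 0 v = 0" "starV \<Omega> v 0 = 0"
    "triL \<Omega> 0 a = 0" "triL \<Omega> v 0 = 0" "triR \<Omega> 0 a = 0" "triR \<Omega> v 0 = 0"
    "hV \<Omega> 0 v = 0" "hV \<Omega> v 0 = 0" "brV \<Omega> 0 v = 0" "brV \<Omega> v 0 = 0"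
proof -
  have b: "bilinear_map sA sV sV (lA \<Omega>)" "bilinear_map sA sV sV (rA \<Omega>)"
    "bilinear_map sV sA sA (lV \<Omega>)" "bilinear_map sV sA sA (rV \<Omega>)"
    "bilinear_map sV sV sA (fV \<Omega>)" "bilinear_map sV sV sV (starV \<Omega>)"
    "bilinear_map sV sA sV (triL \<Omega>)" "bilinear_map sV sA sA (triR \<Omega>)"
    "bilinear_map sV sV sA (hV \<Omega>)" "bilinear_map sV sV sV (brV \<Omega>)"
    using assms by (simp_all add: is_ext_datum_def)
  show "lA \<Omega> 0 v = 0" "lA \<Omega> a 0 = 0" "rA \<Omega> 0 v = 0" "rA \<Omega> a 0 = 0"
    "lV \<Omega> 0 a = 0" "lV \<Omega> v 0 = 0" "rV \<Omega> 0 a = 0" "rV \<Omega> v 0 = 0"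
    "fV \<Omega> 0 v = 0" "fV \<Omega> v 0 = 0" "starV \<Omega> 0 v = 0" "starV \<Omega> v 0 = 0"
    "triL \<Omega> 0 a = 0" "triL \<Omega> v 0 = 0" "triR \<Omega> 0 a = 0" "triR \<Omega> v 0 = 0"
    "hV \<Omega> 0 v = 0" "hV \<Omega> v 0 = 0" "brV \<Omega> 0 v = 0" "brV \<Omega> v 0 = 0"
    by (rule b[THEN bilinear_mapD(9)] b[THEN bilinear_mapD(10)])+
qed

locale one_dimensional = vector_space sV
  for sV :: "'k::field \<Rightarrow> 'v::ab_group_add \<Rightarrow> 'v" +
  fixes x :: 'v
  assumes x_nonzero [simp]: "x \<noteq> 0" and span_x: "span {x} = UNIV"
begin

lemma multiple: "\<exists>s. v = sV s x"
  using span_x span_singleton[of x] by blast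

lemma multiple_eq [simp]: "sV s x = sV r x \<longleftrightarrow> s = r"
  using x_nonzero by (metis scale_right_imp_eq)

lemma representation_multiple [simp]: "representation {x} (sV s x) x = s"
  by (simp add: representation_scale representation_basis x_nonzero span_x)

end

locale flag_complement = gd_bialgebra sA circ br + V: one_dimensional sV x
  for sA :: "'k::field \<Rightarrow> 'a::ab_group_add \<Rightarrow> 'a" and circ br
    and sV :: "'k \<Rightarrow> 'v::ab_group_add \<Rightarrow> 'v" and x
begin

sublocale AV: vector_space_prod sA sV ..

text \<open>The first use of the coordinates, on the product of A and V; the second, on E, occurs in
  the theorem.\<close>

sublocale P: flag_coordinates sA circ br "module_prod.scale sA sV" "\<lambda>a s. (a, sV s x)"
proof unfold_locales
  show "\<exists>a s. u = (a, sV s x)" for u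
    using V.multiple[of "snd u"] by (cases u) auto
qed (simp_all add: AV.scale_prod V.scale_left_distrib)

abbreviation "\<Omega> \<equiv> flag_ext_datum sA sV x"

text \<open>This carries the results about \<open>fcirc\<close> and \<open>fbr\<close> over to
  unified products.\<close>

lemma unified_flag: "unified_circ circ (\<Omega> t) = P.fcirc t" "unified_br br (\<Omega> t) = P.fbr t"
proof -
  obtain p q S T a1 k \<eta> D where t: "t = (p, q, S, T, a1, k, \<eta>, D)" by (rule flag_cases)
  have "unified_circ circ (\<Omega> t) u w = P.fcirc t u w" "unified_br br (\<Omega> t) u w = P.fbr t u w" for u w
  proof -
    obtain a s b r where u: "u = (a, sV s x)" "w = (b, sV r x)" using P.m_surj by metis
    show "unified_circ circ (\<Omega> t) u w = P.fcirc t u w" "unified_br br (\<Omega> t) u w = P.fbr t u w"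
      unfolding u t P.fcirc_m P.fbr_m
      by (simp_all add: unified_circ_def unified_br_def flag_ext_datum_def algebra_simps)
  qed
  then show "unified_circ circ (\<Omega> t) = P.fcirc t" "unified_br br (\<Omega> t) = P.fbr t" by blast+
qed

lemma is_ext_datum_flag:
  assumes "linear_flag sA t"
  shows "is_ext_datum sA sV (\<Omega> t)"
proof -
  obtain p q S T a1 k \<eta> D where t: "t = (p, q, S, T, a1, k, \<eta>, D)" by (rule flag_cases)
  note L = assms[unfolded t linear_flag.simps]
  have add: "V.representation {x} (v + w) x = V.representation {x} v x + V.representation {x} w x"
    and sc: "V.representation {x} (sV r v) x = r * V.representation {x} v x" for v w r
    by (simp_all add: V.representation_add V.representation_scale V.x_nonzero V.span_x)
  show ?thesis
    using L unfolding is_ext_datum_def t flag_ext_datum_def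
    by (auto simp: Vector_Spaces.linear_iff add sc algebra_simps
        intro!: bilinear_mapI vector_space_axioms V.vector_space_axioms)
qed

text \<open>All ten maps are components of products of vectors \<open>(a, 0)\<close> and
  \<open>(0, v)\<close>, once the terms at 0 are removed.\<close>

lemma unified_inj:
  assumes "is_ext_datum sA sV \<Omega>1" "is_ext_datum sA sV \<Omega>2"
    and "unified_circ circ \<Omega>1 = unified_circ circ \<Omega>2" "unified_br br \<Omega>1 = unified_br br \<Omega>2"
  shows "\<Omega>1 = \<Omega>2"
proof -
  have c: "unified_circ circ \<Omega>1 u w = unified_circ circ \<Omega>2 u w"
    and b: "unified_br br \<Omega>1 u w = unified_br br \<Omega>2 u w" for u w
    using assms by simp_all
  note z = ext_datum_zero[OF assms(1)] ext_datum_zero[OF assms(2)]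
  have "lA \<Omega>1 a v = lA \<Omega>2 a v" "rV \<Omega>1 v a = rV \<Omega>2 v a"
    "rA \<Omega>1 a v = rA \<Omega>2 a v" "lV \<Omega>1 v a = lV \<Omega>2 v a"
    "fV \<Omega>1 v w = fV \<Omega>2 v w" "starV \<Omega>1 v w = starV \<Omega>2 v w"
    "triL \<Omega>1 v a = triL \<Omega>2 v a" "triR \<Omega>1 v a = triR \<Omega>2 v a"
    "hV \<Omega>1 v w = hV \<Omega>2 v w" "brV \<Omega>1 v w = brV \<Omega>2 v w" for a v w
    using c[of "(a, 0)" "(0, v)"] c[of "(0, v)" "(a, 0)"] c[of "(0, v)" "(0, w)"]
      b[of "(0, v)" "(a, 0)"] b[of "(0, v)" "(0, w)"]
    by (simp_all add: unified_circ_def unified_br_def z circ_lin br_lin)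
  then show ?thesis
    by (intro ext_datum.equality ext) simp_all
qed

text \<open>The inclusion is written with \<open>sV 0 x\<close> so that it is literally
  \<open>m a 0\<close> for the coordinates \<open>P\<close>.\<close>

lemma unified_ext_structure:
  assumes "\<Omega>' \<in> GD sA circ br sV"
  shows "(unified_circ circ \<Omega>', unified_br br \<Omega>')
    \<in> ext_structures (module_prod.scale sA sV) sA circ br (\<lambda>a. (a, sV 0 x))"
proof -
  have D: "is_ext_datum sA sV \<Omega>'" using assms by (simp add: GD_def)
  note z = ext_datum_zero[OF D]
  show ?thesis
    using assms unfolding ext_structures_def gd_hom_def Vector_Spaces.linear_iff
    by (simp add: GD_def unified_circ_def unified_br_def z vector_space_axioms
        AV.p.vector_space_axioms AV.scale_prod)
qed

text \<open>For surjectivity, the unified product of an extending structure has a flag datum by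
  \<open>ext_structure_flag\<close>, and \<open>unified_inj\<close> identifies the two extending
  data. The vanishing of \<open>hV\<close> and \<open>brV\<close> is thereby derived.\<close>

lemma bij_flag_ext_datum: "bij_betw \<Omega> (gd_flag_data sA circ br) (GD sA circ br sV)"
proof (rule bij_betwI')
  show "(\<Omega> t = \<Omega> t') = (t = t')"
    if "t \<in> gd_flag_data sA circ br" "t' \<in> gd_flag_data sA circ br" for t t'
    using that[THEN gd_flag_data_linear] P.flag_structure_inj[of t t'] unified_flag by metis
  show "\<Omega> t \<in> GD sA circ br sV" if "t \<in> gd_flag_data sA circ br" for t
    using that P.gd_of_flag_datum is_ext_datum_flag[OF gd_flag_data_linear]
    by (simp add: GD_def unified_flag)
  show "\<exists>t\<in>gd_flag_data sA circ br. \<Omega>' = \<Omega> t" if GD: "\<Omega>' \<in> GD sA circ br sV" for \<Omega>'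
  proof -
    obtain t where t: "t \<in> gd_flag_data sA circ br" "unified_circ circ \<Omega>' = P.fcirc t"
      "unified_br br \<Omega>' = P.fbr t"
      using P.ext_structure_flag[OF unified_ext_structure[OF GD]] by blast
    have "\<Omega>' = \<Omega> t"
      using GD t is_ext_datum_flag[OF gd_flag_data_linear[OF t(1)]]
      by (intro unified_inj) (simp_all add: GD_def unified_flag)
    with t show ?thesis by blast
  qed
qed

text \<open>On a line, \<open>lam\<close> and \<open>mu\<close> amount to \<open>a0 = lam x\<close>
  and the scalar \<beta> with \<open>mu x = sV \<beta> x\<close>. At x, the conditions become
  (FD1)-(FD5) and equality of p, q, \<eta>; those for \<open>hV\<close> and \<open>brV\<close> hold
  because their right sides are alternating on multiples of x.\<close>

lemma GD_equiv_flag: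
  assumes "t \<in> gd_flag_data sA circ br" "t' \<in> gd_flag_data sA circ br"
  shows "(\<Omega> t, \<Omega> t') \<in> GD_equiv sA circ br sV \<longleftrightarrow> (t, t') \<in> gd_flag_equiv sA circ br"
proof -
  obtain p q S T a1 k \<eta> D where t: "t = (p, q, S, T, a1, k, \<eta>, D)" by (rule flag_cases)
  obtain p' q' S' T' a1' k' \<eta>' D' where t': "t' = (p', q', S', T', a1', k', \<eta>', D')"
    by (rule flag_cases)
  note lins = linear_flagD[OF gd_flag_data_linear[OF assms(1)[unfolded t]]]
    linear_flagD[OF gd_flag_data_linear[OF assms(2)[unfolded t']]]
  note L = lins[THEN linear_mapD(1)] lins[THEN linear_mapD(2)] lins[THEN linear_mapD(3)]
    lins[THEN linear_mapD(4)] lins[THEN linear_mapD(5)]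
  have mem: "\<Omega> t \<in> GD sA circ br sV" "\<Omega> t' \<in> GD sA circ br sV"
    using assms bij_betwE[OF bij_flag_ext_datum] by blast+
  show ?thesis
  proof
    assume "(\<Omega> t, \<Omega> t') \<in> GD_equiv sA circ br sV"
    then obtain lam mu where lam: "Vector_Spaces.linear sV sA lam"
      and mu: "Vector_Spaces.linear sV sV mu" "bij mu"
      and eqs: "\<And>a. rA (\<Omega> t) a x = inv mu (rA (\<Omega> t') a (mu x))"
        "\<And>a. lA (\<Omega> t) a x = inv mu (lA (\<Omega> t') a (mu x))"
        "\<And>a. lV (\<Omega> t) x a = circ (lam x) a + lV (\<Omega> t') (mu x) a - lam (inv mu (rA (\<Omega> t') a (mu x)))"
        "\<And>a. rV (\<Omega> t) x a = circ a (lam x) + rV (\<Omega> t') (mu x) a - lam (inv mu (lA (\<Omega> t') a (mu x)))"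
        "starV (\<Omega> t) x x = inv mu (starV (\<Omega> t') (mu x) (mu x)) + inv mu (lA (\<Omega> t') (lam x) (mu x))
           + inv mu (rA (\<Omega> t') (lam x) (mu x))"
        "fV (\<Omega> t) x x = circ (lam x) (lam x) + lV (\<Omega> t') (mu x) (lam x) + rV (\<Omega> t') (mu x) (lam x)
           + fV (\<Omega> t') (mu x) (mu x) - lam (inv mu (starV (\<Omega> t') (mu x) (mu x)))
           - lam (inv mu (lA (\<Omega> t') (lam x) (mu x))) - lam (inv mu (rA (\<Omega> t') (lam x) (mu x)))"
        "\<And>a. triL (\<Omega> t) x a = inv mu (triL (\<Omega> t') (mu x) a)"
        "\<And>a. triR (\<Omega> t) x a = br (lam x) a + triR (\<Omega> t') (mu x) a - lam (inv mu (triL (\<Omega> t') (mu x) a))"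
      unfolding GD_equiv_def mem_Collect_eq prod.case by metis
    obtain \<beta> where \<beta>: "mu x = sV \<beta> x" using V.multiple by blast
    have "\<beta> \<noteq> 0"
    proof
      assume "\<beta> = 0"
      with \<beta> have "mu x = mu 0" by (simp add: linear_mapD[OF mu(1)])
      with mu(2) V.x_nonzero show False by (simp add: bij_def inj_eq)
    qed
    have inv_mu: "inv mu (sV s x) = sV (s / \<beta>) x" for s
    proof -
      have "mu (sV (s / \<beta>) x) = sV s x"
        using \<open>\<beta> \<noteq> 0\<close> by (simp add: linear_mapD[OF mu(1)] \<beta>)
      with mu(2) show ?thesis by (metis bij_is_inj inv_f_f)
    qed
    have lam_x: "lam (sV s x) = sA s (lam x)" for s by (rule linear_mapD[OF lam])
    have c: "V.representation {x} x x = 1" using V.representation_multiple[of 1] by simp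
    note ev = t t' flag_ext_datum_def \<beta> inv_mu lam_x c \<open>\<beta> \<noteq> 0\<close>
    have pqe: "q = q'" "p = p'" "\<eta> = \<eta>'"
      using eqs(1,2,7) \<open>\<beta> \<noteq> 0\<close> by (auto simp: ev)
    have k: "k = \<beta> * k' + p (lam x) + q (lam x)"
      using eqs(5) \<open>\<beta> \<noteq> 0\<close> by (simp add: ev pqe V.scale_left_distrib[symmetric])
    have a1: "a1 = circ (lam x) (lam x) + sA \<beta> (S' (lam x)) + sA \<beta> (T' (lam x)) + sA (\<beta>\<^sup>2) a1' - sA k (lam x)"
      using eqs(6) \<open>\<beta> \<noteq> 0\<close> by (simp add: ev pqe k power2_eq_square algebra_simps)
    have "S a = circ (lam x) a + sA \<beta> (S' a) - sA (q a) (lam x) \<and>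
      T a = circ a (lam x) + sA \<beta> (T' a) - sA (p a) (lam x) \<and>
      D a = sA \<beta> (D' a) + br (lam x) a - sA (\<eta> a) (lam x)" for a
      using eqs(3,4,8)[of a] \<open>\<beta> \<noteq> 0\<close> by (simp add: ev pqe add.commute)
    with k a1 pqe \<open>\<beta> \<noteq> 0\<close> assms show "(t, t') \<in> gd_flag_equiv sA circ br"
      unfolding gd_flag_equiv_def t t' by blast
  next
    assume "(t, t') \<in> gd_flag_equiv sA circ br"
    then obtain a0 \<beta> where eqs: "p' = p" "q' = q" "\<eta>' = \<eta>" and "\<beta> \<noteq> 0"
      and FD: "\<And>a. S a = circ a0 a + sA \<beta> (S' a) - sA (q a) a0"
        "\<And>a. T a = circ a a0 + sA \<beta> (T' a) - sA (p a) a0"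
        "a1 = circ a0 a0 + sA \<beta> (S' a0) + sA \<beta> (T' a0) + sA (\<beta>\<^sup>2) a1' - sA k a0"
        "k = \<beta> * k' + p a0 + q a0"
        "\<And>a. D a = sA \<beta> (D' a) + br a0 a - sA (\<eta> a) a0"
      unfolding gd_flag_equiv_def t t' by blast
    \<comment> \<open>The linear extensions of sending x to \<open>a0\<close> and to
      \<open>sV \<beta> x\<close>; \<open>mu\<close> is invertible since \<beta> \<noteq> 0.\<close>
    define lam where "lam v = sA (V.representation {x} v x) a0" for v
    define mu where "mu = sV \<beta>"
    have lam: "Vector_Spaces.linear sV sA lam"
      unfolding lam_def Vector_Spaces.linear_iff
      by (simp add: V.representation_add V.representation_scale V.x_nonzero V.span_x
          scale_left_distrib vector_space_axioms V.vector_space_axioms)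
    have mu: "Vector_Spaces.linear sV sV mu"
      unfolding mu_def by (rule V.linear_scale_self)
    have "bij mu"
      using \<open>\<beta> \<noteq> 0\<close> by (intro o_bij[of "sV (1 / \<beta>)"]) (auto simp: mu_def)
    have inv_mu: "inv (sV \<beta>) v = sV (1 / \<beta>) v" for v
      using \<open>bij mu\<close> \<open>\<beta> \<noteq> 0\<close> by (intro inv_f_eq) (auto simp: mu_def bij_def)
    note ev = t t' flag_ext_datum_def inv_mu mu_def lam_def eqs L circ_lin br_lin br_self
    have "(rA (\<Omega> t) a v = inv mu (rA (\<Omega> t') a (mu v)) \<and>
         lA (\<Omega> t) a v = inv mu (lA (\<Omega> t') a (mu v)) \<and>
         lV (\<Omega> t) v a = circ (lam v) a + lV (\<Omega> t') (mu v) a - lam (inv mu (rA (\<Omega> t') a (mu v))) \<and>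
         rV (\<Omega> t) v a = circ a (lam v) + rV (\<Omega> t') (mu v) a - lam (inv mu (lA (\<Omega> t') a (mu v))) \<and>
         starV (\<Omega> t) v w = inv mu (starV (\<Omega> t') (mu v) (mu w)) + inv mu (lA (\<Omega> t') (lam v) (mu w))
           + inv mu (rA (\<Omega> t') (lam w) (mu v)) \<and>
         fV (\<Omega> t) v w = circ (lam v) (lam w) + lV (\<Omega> t') (mu v) (lam w) + rV (\<Omega> t') (mu w) (lam v)
           + fV (\<Omega> t') (mu v) (mu w) - lam (inv mu (starV (\<Omega> t') (mu v) (mu w)))
           - lam (inv mu (lA (\<Omega> t') (lam v) (mu w))) - lam (inv mu (rA (\<Omega> t') (lam w) (mu v))) \<and>
         triL (\<Omega> t) v a = inv mu (triL (\<Omega> t') (mu v) a) \<and>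
         triR (\<Omega> t) v a = br (lam v) a + triR (\<Omega> t') (mu v) a - lam (inv mu (triL (\<Omega> t') (mu v) a)) \<and>
         hV (\<Omega> t) v w = br (lam v) (lam w) + triR (\<Omega> t') (mu v) (lam w) - triR (\<Omega> t') (mu w) (lam v)
           + hV (\<Omega> t') (mu v) (mu w) - lam (inv mu (brV (\<Omega> t') (mu v) (mu w)))
           - lam (inv mu (triL (\<Omega> t') (mu v) (lam w))) + lam (inv mu (triL (\<Omega> t') (mu w) (lam v))) \<and>
         brV (\<Omega> t) v w = inv mu (brV (\<Omega> t') (mu v) (mu w)) + inv mu (triL (\<Omega> t') (mu v) (lam w))
           - inv mu (triL (\<Omega> t') (mu w) (lam v)))" for a v w
    proof -
      obtain s r where v: "v = sV s x" "w = sV r x" using V.multiple by metis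
      show ?thesis
        unfolding v
        by (intro conjI; simp add: ev \<open>\<beta> \<noteq> 0\<close>)
          (simp_all add: FD power2_eq_square V.representation_zero \<open>\<beta> \<noteq> 0\<close> field_simps)
    qed
    with mem lam mu \<open>bij mu\<close> show "(\<Omega> t, \<Omega> t') \<in> GD_equiv sA circ br sV"
      unfolding GD_equiv_def by blast
  qed
qed

end

section \<open>Transport from the product of A and V to E, and the two bijections\<close>

theorem theorem4p3:
  fixes sA :: "'k::field \<Rightarrow> 'a::ab_group_add \<Rightarrow> 'a"
    and circ br :: "'a \<Rightarrow> 'a \<Rightarrow> 'a"
    and sE :: "'k \<Rightarrow> 'e::ab_group_add \<Rightarrow> 'e"
    and \<iota> :: "'a \<Rightarrow> 'e"
    and sV :: "'k \<Rightarrow> 'v::ab_group_add \<Rightarrow> 'v"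
    and \<kappa> :: "'v \<Rightarrow> 'e"
    and x :: 'v
  assumes "gd_bialgebra sA circ br"
    and "vector_space sE"
    and "Vector_Spaces.linear sA sE \<iota>" and "inj \<iota>"
    and "vector_space sV" and "x \<noteq> 0" and "module.span sV {x} = UNIV"
    and "Vector_Spaces.linear sV sE \<kappa>" and "inj \<kappa>"
    and "range \<iota> \<inter> range \<kappa> = {0}" and "\<forall>u. \<exists>a v. u = \<iota> a + \<kappa> v"
  shows "equiv (gd_flag_data sA circ br) (gd_flag_equiv sA circ br) \<and>
    (\<exists>\<Phi> \<Psi>.
       bij_betw \<Phi> (gd_flag_data sA circ br // gd_flag_equiv sA circ br) (GH2 sA circ br sV) \<and>
       bij_betw \<Psi> (GH2 sA circ br sV) (Extd sE sA circ br \<iota>) \<and>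
       (\<forall>t \<in> gd_flag_data sA circ br.
          \<Phi> (gd_flag_equiv sA circ br `` {t}) = GD_equiv sA circ br sV `` {flag_ext_datum sA sV x t} \<and>
          \<Psi> (\<Phi> (gd_flag_equiv sA circ br `` {t})) =
            ext_iso sE sA circ br \<iota> `` {GD_flag sA circ br sV \<iota> \<kappa> x t}))"
proof -
  interpret A: flag_complement sA circ br sV x
    using assms by (simp add: flag_complement_def one_dimensional_def one_dimensional_axioms_def)
  interpret E: vector_space sE by fact
  note \<iota> = linear_mapD[OF assms(3)] and \<kappa> = linear_mapD[OF assms(8)]
  \<comment> \<open>The sum is direct: the common value
    \<open>\<iota> (a - b) = \<kappa> (w - v)\<close> lies in both ranges and hence is 0.\<close>
  have inj_sum: "a = b \<and> v = w" if "\<iota> a + \<kappa> v = \<iota> b + \<kappa> w" for a b v w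
  proof -
    have eq: "\<iota> (a - b) = \<kappa> (w - v)" using that by (simp add: \<iota> \<kappa> algebra_simps)
    then have "\<iota> (a - b) \<in> range \<iota> \<inter> range \<kappa>" by (metis IntI rangeI)
    with assms(10) eq have "\<iota> (a - b) = 0" "\<kappa> (w - v) = 0" by simp_all
    then have "\<iota> (a - b) = \<iota> 0" "\<kappa> (w - v) = \<kappa> 0" by (simp_all add: \<iota> \<kappa>)
    with assms(4,9) show ?thesis by (simp add: inj_eq)
  qed
  interpret Q: flag_coordinates sA circ br sE "\<lambda>a s. \<iota> a + \<kappa> (sV s x)"
  proof unfold_locales
    show "\<exists>a s. u = \<iota> a + \<kappa> (sV s x)" for u
    proof -
      obtain a v where "u = \<iota> a + \<kappa> v" using assms(11) by blast
      moreover obtain s where "v = sV s x" using A.V.multiple by blast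
      ultimately show ?thesis by blast
    qed
    show "(\<iota> a + \<kappa> (sV s x) = \<iota> b + \<kappa> (sV r x)) = (a = b \<and> s = r)" for a b s r
      using inj_sum[of a "sV s x" b "sV r x"] by auto
  qed (simp_all add: \<iota> \<kappa> A.V.scale_left_distrib E.scale_right_distrib)
  \<comment> \<open>Results about \<open>Q\<close> mention the inclusion in the form
    \<open>m a 0\<close>; this turns it back into \<open>\<iota>\<close>.\<close>
  have Q_emb: "(\<lambda>a. \<iota> a + \<kappa> (sV 0 x)) = \<iota>" by (simp add: \<kappa>)
  define e where "e = (\<lambda>(a, v). \<iota> a + \<kappa> v)"
  \<comment> \<open>\<open>G\<close> extends the transport in \<open>GD_flag\<close> to all
    extending data, as the second bijection has to be defined on \<open>GH2\<close>.\<close>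
  define G :: "('a, 'v) ext_datum \<Rightarrow> 'e gd_structure" where
    "G \<Omega> = (\<lambda>u w. e (unified_circ circ \<Omega> (inv e u) (inv e w)),
       \<lambda>u w. e (unified_br br \<Omega> (inv e u) (inv e w)))" for \<Omega>
  have "inj e" by (auto intro!: injI dest: inj_sum simp: e_def)
  then have inv_e: "inv e (\<iota> a + \<kappa> v) = (a, v)" for a v
    by (intro inv_f_eq) (simp_all add: e_def)
  have flag_G: "GD_flag sA circ br sV \<iota> \<kappa> x t = G (A.\<Omega> t)" for t
    by (simp add: GD_flag_def G_def e_def Let_def)
  \<comment> \<open>Both structures have the same formula in coordinates, and \<open>e\<close>
    matches the coordinates of \<open>P\<close> with those of \<open>Q\<close>.\<close>
  have G_flag: "G (A.\<Omega> t) = (Q.fcirc t, Q.fbr t)" for t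
  proof -
    obtain p q S T a1 k \<eta> D where t: "t = (p, q, S, T, a1, k, \<eta>, D)" by (rule flag_cases)
    have "e (A.P.fcirc t (inv e u) (inv e w)) = Q.fcirc t u w"
      "e (A.P.fbr t (inv e u) (inv e w)) = Q.fbr t u w" for u w
    proof -
      obtain a s b r where u: "u = \<iota> a + \<kappa> (sV s x)" "w = \<iota> b + \<kappa> (sV r x)"
        using Q.m_surj by metis
      show "e (A.P.fcirc t (inv e u) (inv e w)) = Q.fcirc t u w"
        "e (A.P.fbr t (inv e u) (inv e w)) = Q.fbr t u w"
        unfolding t u inv_e A.P.fcirc_m A.P.fbr_m Q.fcirc_m Q.fbr_m by (simp_all add: e_def)
    qed
    then show ?thesis by (simp add: G_def A.unified_flag fun_eq_iff)
  qed
  let ?F = "gd_flag_data sA circ br" and ?R = "gd_flag_equiv sA circ br"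
  let ?X = "ext_structures sE sA circ br \<iota>" and ?I = "ext_iso sE sA circ br \<iota>"
  let ?GD = "GD sA circ br sV" and ?E = "GD_equiv sA circ br sV"
  have iso: "(G (A.\<Omega> t), G (A.\<Omega> t')) \<in> ?I \<longleftrightarrow> (t, t') \<in> ?R" if "t \<in> ?F" "t' \<in> ?F" for t t'
    using Q.ext_iso_flag[OF that] unfolding Q_emb G_flag .
  have GX: "G (A.\<Omega> t) \<in> ?X" if "t \<in> ?F" for t
    using Q.flag_ext_structure[OF that] unfolding Q_emb G_flag .
  have img: "A.\<Omega> ` ?F = ?GD" using A.bij_flag_ext_datum by (simp add: bij_betw_def)
  have "bij_betw (G \<circ> A.\<Omega>) ?F ?X"
  proof (rule bij_betwI')
    show "((G \<circ> A.\<Omega>) t = (G \<circ> A.\<Omega>) t') = (t = t')" if "t \<in> ?F" "t' \<in> ?F" for t t'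
      using that[THEN gd_flag_data_linear] Q.flag_structure_inj[of t t'] by (auto simp: G_flag)
    show "(G \<circ> A.\<Omega>) t \<in> ?X" if "t \<in> ?F" for t using GX[OF that] by simp
    show "\<exists>t\<in>?F. X = (G \<circ> A.\<Omega>) t" if mem: "X \<in> ?X" for X
    proof -
      obtain c b where X: "X = (c, b)" by (cases X)
      obtain t where "t \<in> ?F" "c = Q.fcirc t" "b = Q.fbr t"
        using Q.ext_structure_flag[of c b] mem[unfolded X] unfolding Q_emb by blast
      then show ?thesis by (intro bexI[of _ t]) (simp_all add: X G_flag)
    qed
  qed
  \<comment> \<open>The composite and the first factor are bijective, hence so is
    \<open>G\<close>.\<close>
  then have bij_G: "bij_betw G ?GD ?X"
    using A.bij_flag_ext_datum by (simp add: bij_betw_comp_iff)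
  have R: "?R \<subseteq> ?F \<times> ?F" and E: "?E \<subseteq> ?GD \<times> ?GD" and I: "?I \<subseteq> ?X \<times> ?X"
    by (auto simp: gd_flag_equiv_def GD_equiv_def ext_iso_def)
  \<comment> \<open>Every extending structure comes from a flag datum, and both relations restrict
    there to the flag relation.\<close>
  have GE: "\<forall>\<Omega>1\<in>?GD. \<forall>\<Omega>2\<in>?GD. (G \<Omega>1, G \<Omega>2) \<in> ?I \<longleftrightarrow> (\<Omega>1, \<Omega>2) \<in> ?E"
    using iso A.GD_equiv_flag unfolding img[symmetric] by auto
  have FE: "\<forall>t\<in>?F. \<forall>t'\<in>?F. (A.\<Omega> t, A.\<Omega> t') \<in> ?E \<longleftrightarrow> (t, t') \<in> ?R"
    using A.GD_equiv_flag by blast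
  note \<Phi> = bij_betw_quotient[OF A.bij_flag_ext_datum R E FE]
  note \<Psi> = bij_betw_quotient[OF bij_G E I GE]
  have "equiv ?F ?R"
  proof (rule equiv_of_embedding[OF equiv_ext_iso R])
    show "(\<lambda>t. G (A.\<Omega> t)) ` ?F \<subseteq> ?X" using GX by blast
  qed (rule iso)
  moreover have "\<forall>t\<in>?F. A.\<Omega> ` (?R `` {t}) = ?E `` {A.\<Omega> t} \<and>
      G ` (A.\<Omega> ` (?R `` {t})) = ?I `` {GD_flag sA circ br sV \<iota> \<kappa> x t}"
  proof (intro ballI conjI)
    fix t assume t: "t \<in> ?F"
    show *: "A.\<Omega> ` (?R `` {t}) = ?E `` {A.\<Omega> t}" by (rule \<Phi>(2)[OF t])
    show "G ` (A.\<Omega> ` (?R `` {t})) = ?I `` {GD_flag sA circ br sV \<iota> \<kappa> x t}"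
      unfolding * flag_G by (rule \<Psi>(2)) (use t img in blast)
  qed
  \<comment> \<open>Classes are sets, so the witnesses are the image maps induced by
    \<open>A.\<Omega>\<close> and \<open>G\<close>.\<close>
  ultimately show ?thesis
    using \<Phi>(1) \<Psi>(1) unfolding GH2_def Extd_def
    by (intro conjI exI[of _ "(`) A.\<Omega>"] exI[of _ "(`) G"])
qed

end
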